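(* Let $\sigma\in\mathfrak{S}_n$, $1\le k<n$, let $\zeta=\zeta(\sigma,k)$ be the element of maximal length of the coset $\sigma(\mathfrak{S}_k\times\mathfrak{S}_{n-k})$, and let $W_{\sigma,k}=(\tau_1\prec\tau_2\prec\dots\prec\tau_m)$. Then $$K_\omega\,\hat\pi_{\omega\zeta}\,\pi_{\zeta^{-1}\sigma}=\mathfrak{E}_{\sigma},\qquad\text{where}\qquad \mathfrak{E}_{\sigma}:=K_\sigma\cdot(1-\tau_1)\cdot(1-\tau_2)\cdots(1-\tau_m).$$
   Context: Permutations are in one-line notation; $(\sigma\tau)(i)=\sigma(\tau(i))$; $s_i=(i,i+1)$; $\ell$ is Coxeter length; $\omega=[n,n-1,\dots,1]$. Transpositions are written $(a,b)$ with $a<b$. Module and operators. Consider the free $\mathbb{Z}$-module with basis of formal symbols $(K_\sigma)_{\sigma\in\mathfrak{S}_n}$. For $1\le i<n$ define right operators by $K_\sigma\pi_i=K_{\sigma s_i}$ if $\sigma(i)>\sigma(i+1)$ and $K_\sigma\pi_i=K_\sigma$ otherwise, and $\hat\pi_i=\pi_i-1$. Both families satisfy the braid relations, so for a reduced decomposition $\mu=s_{i_1}\cdots s_{i_m}$ one sets $\pi_\mu=\pi_{i_1}\cdots\pi_{i_m}$ and $\hat\pi_\mu=\hat\pi_{i_1}\cdots\hat\pi_{i_m}$ (applied from left to right). The coset: $\zeta$ is obtained from $\sigma$ by sorting the values in positions $1,\dots,k$ decreasingly and the values in positions $k+1,\dots,n$ decreasingly. A transposition $\tau$ is a Bruhat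 transposition of $\sigma$ if $\ell(\sigma\tau)=\ell(\sigma)+1$; it is a $k$-Bruhat transposition if moreover $\tau=(a,b)$ with $a\le k<b$. $W_{\sigma,k}$ is the list of all $k$-Bruhat transpositions of $\sigma$, totally ordered by: $(a,b)\prec(a',b')$ if and only if $\sigma(a)>\sigma(a')$, or $a=a'$ and $\sigma(b)<\sigma(b')$. The dot action is linear, with $K_\mu\cdot 1=K_\mu$ and, for a transposition $\tau$, $K_\mu\cdot\tau=K_{\mu\tau}$ if $\tau$ is a Bruhat transposition of $\mu$, and $K_\mu\cdot\tau=0$ otherwise; factors are applied from left to right. *)

theory Defs
  imports "HOL-Combinatorics.Combinatorics" "HOL-Library.Poly_Mapping"
begin

text \<open>
  The symmetric group on \<open>n\<close> letters is the set of functions \<open>\<sigma> :: nat \<Rightarrow> nat\<close> with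
  \<open>\<sigma> permutes {1..n}\<close> (so \<open>\<sigma>\<close> is the identity outside \<open>{1..n}\<close>), with product \<open>\<circ>\<close>.
\<close>

definition longest_perm :: "nat \<Rightarrow> nat \<Rightarrow> nat" where
  "longest_perm n i = (if i \<in> {1..n} then n + 1 - i else i)"


subsection \<open>Reduced decompositions and Coxeter length\<close>

abbreviation simple_transp :: "nat \<Rightarrow> nat \<Rightarrow> nat" where
  "simple_transp i \<equiv> transpose i (Suc i)"

definition word_perm :: "nat list \<Rightarrow> nat \<Rightarrow> nat" where
  "word_perm w = foldr (\<lambda>i \<mu>. simple_transp i \<circ> \<mu>) w id"

definition is_word_for :: "nat \<Rightarrow> (nat \<Rightarrow> nat) \<Rightarrow> nat list \<Rightarrow> bool" where
  "is_word_for n \<mu> w \<longleftrightarrow> set w \<subseteq> {1..<n} \<and> word_perm w = \<mu>"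

definition cox_length :: "nat \<Rightarrow> (nat \<Rightarrow> nat) \<Rightarrow> nat" where
  "cox_length n \<mu> = (LEAST m. \<exists>w. is_word_for n \<mu> w \<and> length w = m)"

definition reduced_word_for :: "nat \<Rightarrow> (nat \<Rightarrow> nat) \<Rightarrow> nat list \<Rightarrow> bool" where
  "reduced_word_for n \<mu> w \<longleftrightarrow> is_word_for n \<mu> w \<and> length w = cox_length n \<mu>"


subsection \<open>The module and the operators \<open>\<pi>\<close> and \<open>\<pi>\<close>-hat\<close>

text \<open>
  The free \<open>\<int>\<close>-module on \<open>(K \<sigma>)\<close>, \<open>\<sigma>\<close> in the symmetric group, is realised as the submodule of
  \<open>(nat \<Rightarrow> nat) \<Rightarrow>\<^sub>0 int\<close> of elements supported on permutations of \<open>{1..n}\<close>; the operators below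
  (\<open>pi_op i\<close> for \<open>1 \<le> i < n\<close>) preserve it.
\<close>

type_synonym perm_module = "(nat \<Rightarrow> nat) \<Rightarrow>\<^sub>0 int"

abbreviation K :: "(nat \<Rightarrow> nat) \<Rightarrow> perm_module" where
  "K \<sigma> \<equiv> frag_of \<sigma>"

definition pi_op :: "nat \<Rightarrow> perm_module \<Rightarrow> perm_module" where
  "pi_op i = frag_extend (\<lambda>\<sigma>. if \<sigma> i > \<sigma> (Suc i) then K (\<sigma> \<circ> simple_transp i) else K \<sigma>)"

definition pi_hat_op :: "nat \<Rightarrow> perm_module \<Rightarrow> perm_module" where
  "pi_hat_op i x = pi_op i x - x"

text \<open>
  Right operators are written as functions: \<open>pi_perm n \<mu> x\<close> is \<open>x \<pi>\<^sub>\<mu>\<close>, the first letter of the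
  word acting first. By the braid relations the result does not depend on the reduced word chosen.
\<close>

definition pi_perm :: "nat \<Rightarrow> (nat \<Rightarrow> nat) \<Rightarrow> perm_module \<Rightarrow> perm_module" where
  "pi_perm n \<mu> x = foldl (\<lambda>y i. pi_op i y) x (SOME w. reduced_word_for n \<mu> w)"

definition pi_hat_perm :: "nat \<Rightarrow> (nat \<Rightarrow> nat) \<Rightarrow> perm_module \<Rightarrow> perm_module" where
  "pi_hat_perm n \<mu> x = foldl (\<lambda>y i. pi_hat_op i y) x (SOME w. reduced_word_for n \<mu> w)"


subsection \<open>The maximal coset representative\<close>

definition young_subgroup :: "nat \<Rightarrow> nat \<Rightarrow> (nat \<Rightarrow> nat) set" where
  "young_subgroup n k = {\<rho>. \<rho> permutes {1..n} \<and> \<rho> ` {1..k} = {1..k}}"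

definition zeta :: "nat \<Rightarrow> nat \<Rightarrow> (nat \<Rightarrow> nat) \<Rightarrow> nat \<Rightarrow> nat" where
  "zeta n k \<sigma> = (ARG_MAX (cox_length n) \<xi>. \<xi> \<in> (\<lambda>\<rho>. \<sigma> \<circ> \<rho>) ` young_subgroup n k)"


subsection \<open>Bruhat transpositions and the dot action\<close>

text \<open>A transposition \<open>(a,b)\<close> with \<open>a < b\<close> is represented by the pair of its entries.\<close>

definition bruhat_transp :: "nat \<Rightarrow> (nat \<Rightarrow> nat) \<Rightarrow> nat \<times> nat \<Rightarrow> bool" where
  "bruhat_transp n \<sigma> = (\<lambda>(a, b). 1 \<le> a \<and> a < b \<and> b \<le> n \<and>
     cox_length n (\<sigma> \<circ> transpose a b) = cox_length n \<sigma> + 1)"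

definition k_bruhat_transps :: "nat \<Rightarrow> nat \<Rightarrow> (nat \<Rightarrow> nat) \<Rightarrow> (nat \<times> nat) set" where
  "k_bruhat_transps n k \<sigma> = {(a, b). bruhat_transp n \<sigma> (a, b) \<and> a \<le> k \<and> k < b}"

definition transp_prec :: "(nat \<Rightarrow> nat) \<Rightarrow> nat \<times> nat \<Rightarrow> nat \<times> nat \<Rightarrow> bool" where
  "transp_prec \<sigma> = (\<lambda>(a, b) (a', b'). \<sigma> a > \<sigma> a' \<or> (a = a' \<and> \<sigma> b < \<sigma> b'))"

definition W_list :: "nat \<Rightarrow> nat \<Rightarrow> (nat \<Rightarrow> nat) \<Rightarrow> (nat \<times> nat) list" where
  "W_list n k \<sigma> = (THE ts. sorted_wrt (transp_prec \<sigma>) ts \<and> set ts = k_bruhat_transps n k \<sigma>)"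

text \<open>\<open>dot_transp n \<tau> x\<close> is \<open>x \<cdot> \<tau>\<close>, and each factor \<open>1 - \<tau>\<close> acts as \<open>x \<mapsto> x - x \<cdot> \<tau>\<close>, leftmost first.\<close>

definition dot_transp :: "nat \<Rightarrow> nat \<times> nat \<Rightarrow> perm_module \<Rightarrow> perm_module" where
  "dot_transp n \<tau> =
     frag_extend (\<lambda>\<mu>. if bruhat_transp n \<mu> \<tau> then K (\<mu> \<circ> transpose (fst \<tau>) (snd \<tau>)) else 0)"

definition frak_E :: "nat \<Rightarrow> nat \<Rightarrow> (nat \<Rightarrow> nat) \<Rightarrow> perm_module" where
  "frak_E n k \<sigma> = foldl (\<lambda>x \<tau>. x - dot_transp n \<tau> x) (K \<sigma>) (W_list n k \<sigma>)"

end

theory Submission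
  imports Defs
begin

text \<open>
  Let \<open>M\<close> be the product of the factors \<open>1 - (a, b)\<close> over all pairs \<open>a \<le> k < b\<close>, with \<open>a\<close> increasing and,
  for equal \<open>a\<close>, \<open>b\<close> decreasing. On \<open>K \<sigma>\<close> it agrees with the product over \<open>W\<close>: a factor that is not a Bruhat
  transposition of \<open>\<sigma>\<close> still acts trivially when its turn comes, and passing from the lexicographic
  order to the order of \<open>W\<close> exchanges only factors with disjoint entries, which commute.

  Both sides are then compared through the left 0-Hecke operators
  \<open>\<lambda>\<^sub>j\<close>, which send \<open>K \<mu>\<close> to \<open>K (s\<^sub>j \<mu>)\<close> if this lowers the length and fix it otherwise. They commute
  with all \<open>\<pi>\<^sub>i\<close>, and the first letter \<open>i\<close> of a reduced word of \<open>\<omega>\<zeta>\<close> acts on \<open>K \<omega>\<close> as \<open>\<lambda>\<^sub>j - 1\<close>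
  with \<open>j = n - i\<close>; so the left-hand side for \<open>\<sigma>\<close> is \<open>\<lambda>\<^sub>j - 1\<close> applied to that for \<open>s\<^sub>j \<sigma>\<close>. The element
  \<open>M (K \<sigma>)\<close> satisfies the same recursion because \<open>j\<close> sits in a position \<open>\<le> k\<close> of \<open>\<sigma>\<close> and \<open>j + 1\<close> in a
  position \<open>> k\<close>; both sides equal \<open>K \<sigma>\<close> when \<open>\<zeta> = \<omega>\<close>.
\<close>

section \<open>Inversions and Coxeter length\<close>

definition inv_num :: "nat \<Rightarrow> (nat \<Rightarrow> nat) \<Rightarrow> nat" where
  "inv_num n \<mu> = card {(c, d). c \<in> {1..n} \<and> d \<in> {1..n} \<and> c < d \<and> \<mu> d < \<mu> c}"

lemma inv_num_eq_sum:
  "inv_num n \<mu> = (\<Sum>c\<in>{1..n}. \<Sum>d\<in>{1..n}. of_bool (c < d \<and> \<mu> d < \<mu> c))"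
proof -
  have "{(c, d). c \<in> {1..n} \<and> d \<in> {1..n} \<and> c < d \<and> \<mu> d < \<mu> c} =
    (SIGMA c:{1..n}. {1..n} \<inter> {d. c < d \<and> \<mu> d < \<mu> c})" by auto
  then show ?thesis by (simp add: inv_num_def)
qed

text \<open>Pairs avoiding \<open>a\<close> and \<open>b\<close> keep their order, and the pair
  \<open>(a, b)\<close> becomes an inversion. Any other position gains two inversions if it lies
  between in position and in value, and none otherwise.\<close>

lemma inv_num_comp_transpose:
  assumes "\<mu> permutes {1..n}" "1 \<le> a" "a < b" "b \<le> n" "\<mu> a < \<mu> b"
  shows "inv_num n (\<mu> \<circ> transpose a b) =
    inv_num n \<mu> + 1 + 2 * card {c. a < c \<and> c < b \<and> \<mu> a < \<mu> c \<and> \<mu> c < \<mu> b}"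
proof -
  define T where "T = {1..n} - {a, b}"
  have ab: "{1..n} = insert a (insert b T)" and T: "a \<notin> T" "b \<notin> T" "finite T"
    using assms by (auto simp: T_def)
  define h :: "(nat \<Rightarrow> nat) \<Rightarrow> nat \<Rightarrow> nat \<Rightarrow> nat"
    where "h \<nu> c d = of_bool (c < d \<and> \<nu> d < \<nu> c)" for \<nu> c d
  let ?\<nu> = "\<mu> \<circ> transpose a b"
  have split: "inv_num n \<nu> = (\<Sum>c\<in>T. \<Sum>d\<in>T. h \<nu> c d) +
      (\<Sum>c\<in>T. h \<nu> a c + h \<nu> c a + h \<nu> b c + h \<nu> c b) + h \<nu> a b" for \<nu>
  proof -
    have "inv_num n \<nu> = (\<Sum>c\<in>insert a (insert b T). \<Sum>d\<in>insert a (insert b T). h \<nu> c d)"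
      unfolding inv_num_eq_sum ab h_def ..
    moreover have "h \<nu> a a = 0" "h \<nu> b b = 0" "h \<nu> b a = 0"
      using \<open>a < b\<close> by (auto simp: h_def)
    ultimately show ?thesis using T \<open>a < b\<close> by (simp add: sum.distrib)
  qed
  have "(\<Sum>c\<in>T. \<Sum>d\<in>T. h ?\<nu> c d) = (\<Sum>c\<in>T. \<Sum>d\<in>T. h \<mu> c d)"
    using T by (intro sum.cong refl) (auto simp: h_def transpose_def)
  moreover have "(\<Sum>c\<in>T. h ?\<nu> a c + h ?\<nu> c a + h ?\<nu> b c + h ?\<nu> c b) =
    (\<Sum>c\<in>T. h \<mu> a c + h \<mu> c a + h \<mu> b c + h \<mu> c b
       + 2 * of_bool (a < c \<and> c < b \<and> \<mu> a < \<mu> c \<and> \<mu> c < \<mu> b))"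
  proof (intro sum.cong refl)
    fix c assume "c \<in> T"
    then have c: "c \<noteq> a" "c \<noteq> b" using T by auto
    then have "\<mu> c \<noteq> \<mu> a" "\<mu> c \<noteq> \<mu> b"
      by (simp_all add: inj_eq[OF permutes_inj[OF assms(1)]])
    then show "h ?\<nu> a c + h ?\<nu> c a + h ?\<nu> b c + h ?\<nu> c b = h \<mu> a c + h \<mu> c a + h \<mu> b c + h \<mu> c b
       + 2 * of_bool (a < c \<and> c < b \<and> \<mu> a < \<mu> c \<and> \<mu> c < \<mu> b)"
      using c \<open>a < b\<close> \<open>\<mu> a < \<mu> b\<close>
      by (cases "c < a"; cases "c < b"; cases "\<mu> c < \<mu> a"; cases "\<mu> c < \<mu> b")
        (simp_all add: h_def)
  qed
  moreover have "\<dots> = (\<Sum>c\<in>T. h \<mu> a c + h \<mu> c a + h \<mu> b c + h \<mu> c b)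
      + 2 * card {c. a < c \<and> c < b \<and> \<mu> a < \<mu> c \<and> \<mu> c < \<mu> b}"
  proof -
    have "{c. a < c \<and> c < b \<and> \<mu> a < \<mu> c \<and> \<mu> c < \<mu> b}
        = T \<inter> {c. a < c \<and> c < b \<and> \<mu> a < \<mu> c \<and> \<mu> c < \<mu> b}"
      using assms by (auto simp: T_def)
    then show ?thesis using T(3) by (simp add: sum.distrib flip: sum_distrib_left)
  qed
  moreover have "h ?\<nu> a b = 1" "h \<mu> a b = 0"
    using assms by (auto simp: h_def)
  ultimately show ?thesis by (simp add: split[of ?\<nu>] split[of \<mu>])
qed

lemma permutes_transpose_comp:
  fixes \<mu> :: "nat \<Rightarrow> nat"
  assumes "\<mu> permutes {1..n}" "1 \<le> a" "a < b" "b \<le> n"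
  shows "\<mu> \<circ> transpose a b permutes {1..n}"
proof (rule permutes_compose[OF _ assms(1)])
  show "transpose a b permutes {1..n}"
    by (rule permutes_swap_id) (use assms(2-4) in auto)
qed

lemma comp_transpose_permutes_iff:
  fixes \<mu> :: "nat \<Rightarrow> nat"
  assumes "1 \<le> a" "a < b" "b \<le> n"
  shows "\<mu> \<circ> transpose a b permutes {1..n} \<longleftrightarrow> \<mu> permutes {1..n}"
proof
  assume "\<mu> \<circ> transpose a b permutes {1..n}"
  from permutes_transpose_comp[OF this assms] show "\<mu> permutes {1..n}"
    by (simp add: comp_assoc)
qed (use permutes_transpose_comp assms in blast)

lemma inv_num_less_comp_transpose:
  assumes "\<mu> permutes {1..n}" "1 \<le> a" "a < b" "b \<le> n" "\<mu> a < \<mu> b"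
  shows "inv_num n \<mu> < inv_num n (\<mu> \<circ> transpose a b)"
  using inv_num_comp_transpose[OF assms] by simp

lemma inv_num_comp_transpose_less_iff:
  assumes "\<mu> permutes {1..n}" "1 \<le> a" "a < b" "b \<le> n"
  shows "inv_num n (\<mu> \<circ> transpose a b) < inv_num n \<mu> \<longleftrightarrow> \<mu> b < \<mu> a"
proof -
  have ne: "\<mu> a \<noteq> \<mu> b" using assms(3) by (simp add: inj_eq[OF permutes_inj[OF assms(1)]])
  show ?thesis
  proof (cases "\<mu> a < \<mu> b")
    case True
    then show ?thesis using inv_num_less_comp_transpose[OF assms] by simp
  next
    case False
    with ne have "\<mu> b < \<mu> a" by simp
    then show ?thesis
      using inv_num_less_comp_transpose[OF permutes_transpose_comp[OF assms] assms(2-4)]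
      by (simp add: comp_assoc)
  qed
qed

lemma inv_num_comp_simple_transp:
  assumes "\<mu> permutes {1..n}" "i \<in> {1..<n}"
  shows "\<mu> i < \<mu> (Suc i) \<Longrightarrow> inv_num n (\<mu> \<circ> simple_transp i) = Suc (inv_num n \<mu>)"
    and "\<mu> (Suc i) < \<mu> i \<Longrightarrow> Suc (inv_num n (\<mu> \<circ> simple_transp i)) = inv_num n \<mu>"
proof -
  have *: "inv_num n (\<nu> \<circ> simple_transp i) = Suc (inv_num n \<nu>)"
    if "\<nu> permutes {1..n}" "\<nu> i < \<nu> (Suc i)" for \<nu>
  proof -
    have "{c. i < c \<and> c < Suc i \<and> \<nu> i < \<nu> c \<and> \<nu> c < \<nu> (Suc i)} = {}" by auto
    then show ?thesis using inv_num_comp_transpose[OF that(1), of i "Suc i"] assms(2) that(2) by simp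
  qed
  from *[OF assms(1)] show "\<mu> i < \<mu> (Suc i) \<Longrightarrow> inv_num n (\<mu> \<circ> simple_transp i) = Suc (inv_num n \<mu>)" .
  have "\<mu> \<circ> simple_transp i permutes {1..n}"
    using assms by (intro permutes_transpose_comp) auto
  from *[OF this] show "\<mu> (Suc i) < \<mu> i \<Longrightarrow> Suc (inv_num n (\<mu> \<circ> simple_transp i)) = inv_num n \<mu>"
    by (simp add: comp_assoc)
qed

section \<open>Words in the simple transpositions and their minimal length\<close>

lemma word_perm_Nil [simp]: "word_perm [] = id"
  by (simp add: word_perm_def)

lemma word_perm_Cons [simp]: "word_perm (i # w) = simple_transp i \<circ> word_perm w"
  by (simp add: word_perm_def)

lemma word_perm_append: "word_perm (v @ w) = word_perm v \<circ> word_perm w"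
  by (induction v) (simp_all add: comp_assoc)

lemma word_perm_snoc: "word_perm (w @ [i]) = word_perm w \<circ> simple_transp i"
  by (simp add: word_perm_append)

lemma word_perm_permutes: "set w \<subseteq> {1..<n} \<Longrightarrow> word_perm w permutes {1..n}"
proof (induction w)
  case Nil
  show ?case unfolding word_perm_Nil by (rule permutes_id)
next
  case (Cons i w)
  then have "simple_transp i permutes {1..n}" by (intro permutes_swap_id) auto
  moreover have "word_perm w permutes {1..n}" by (rule Cons.IH) (use Cons.prems in simp)
  ultimately show ?case unfolding word_perm_Cons by (intro permutes_compose)
qed

lemma inv_num_id [simp]: "inv_num n id = 0"
proof -
  have "{(c, d). c \<in> {1..n} \<and> d \<in> {1..n} \<and> c < d \<and> id d < id c} = {}" by auto
  then show ?thesis unfolding inv_num_def by (metis card.empty)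
qed

lemma inv_num_word_perm_le: "set w \<subseteq> {1..<n} \<Longrightarrow> inv_num n (word_perm w) \<le> length w"
proof (induction w rule: rev_induct)
  case (snoc i w)
  have p: "word_perm w permutes {1..n}" and i: "i \<in> {1..<n}"
    using snoc.prems word_perm_permutes[of w n] by simp_all
  have "word_perm w i \<noteq> word_perm w (Suc i)"
    by (simp add: inj_eq[OF permutes_inj[OF p]])
  then have "inv_num n (word_perm w \<circ> simple_transp i) \<le> Suc (inv_num n (word_perm w))"
    using inv_num_comp_simple_transp[OF p i] by linarith
  also have "\<dots> \<le> Suc (length w)" using snoc by simp
  finally show ?case unfolding word_perm_snoc length_append_singleton .
qed simp

lemma ascending_permutes_eq_id:
  fixes \<mu> :: "nat \<Rightarrow> nat"
  assumes "\<mu> permutes {1..n}" and "\<And>i. i \<in> {1..<n} \<Longrightarrow> \<mu> i < \<mu> (Suc i)"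
  shows "\<mu> = id"
proof (rule permutes_natset_ge[OF assms(1)])
  have "1 \<le> i \<Longrightarrow> i \<le> n \<Longrightarrow> i \<le> \<mu> i" for i
  proof (induction i rule: nat_induct_at_least)
    case base
    then show ?case using permutes_in_image[OF assms(1), of 1] by simp
  next
    case (Suc i)
    then show ?case using assms(2)[of i] by simp
  qed
  then show "\<forall>i\<in>{1..n}. i \<le> \<mu> i" by simp
qed

text \<open>Bubble sort: a permutation other than the identity has a descent, and undoing it removes
  exactly one inversion. The letters used spell the word.\<close>

lemma ex_word_of_inv_num_length:
  assumes "\<mu> permutes {1..n}"
  shows "\<exists>w. is_word_for n \<mu> w \<and> length w = inv_num n \<mu>"
  using assms
proof (induction "inv_num n \<mu>" arbitrary: \<mu> rule: less_induct)
  case less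
  show ?case
  proof (cases "\<mu> = id")
    case True
    then show ?thesis by (auto simp: is_word_for_def intro: exI[of _ "[]"])
  next
    case False
    then obtain i where i: "i \<in> {1..<n}" "\<not> \<mu> i < \<mu> (Suc i)"
      using ascending_permutes_eq_id[OF less.prems] by blast
    moreover have "\<mu> i \<noteq> \<mu> (Suc i)"
      by (simp add: inj_eq[OF permutes_inj[OF less.prems]])
    ultimately have inv: "Suc (inv_num n (\<mu> \<circ> simple_transp i)) = inv_num n \<mu>"
      using inv_num_comp_simple_transp(2)[OF less.prems i(1)] by simp
    moreover have "\<mu> \<circ> simple_transp i permutes {1..n}"
      using i less.prems by (intro permutes_transpose_comp) auto
    ultimately obtain w where w: "is_word_for n (\<mu> \<circ> simple_transp i) w"
        "length w = inv_num n (\<mu> \<circ> simple_transp i)"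
      using less.hyps[of "\<mu> \<circ> simple_transp i"] by auto
    then have "is_word_for n \<mu> (w @ [i])"
      using i(1) by (simp add: is_word_for_def word_perm_snoc comp_assoc)
    with w inv show ?thesis by (intro exI[of _ "w @ [i]"]) simp
  qed
qed

lemma cox_length_eq_inv_num:
  assumes "\<mu> permutes {1..n}"
  shows "cox_length n \<mu> = inv_num n \<mu>"
  unfolding cox_length_def
proof (rule Least_equality)
  show "\<exists>w. is_word_for n \<mu> w \<and> length w = inv_num n \<mu>"
    using ex_word_of_inv_num_length[OF assms] .
qed (auto simp: is_word_for_def inv_num_word_perm_le)

text \<open>Reducedness of the word by itself, so that an induction can shorten the word without
  naming each permutation.\<close>

definition reduced_word :: "nat \<Rightarrow> nat list \<Rightarrow> bool" where
  "reduced_word n w \<longleftrightarrow> set w \<subseteq> {1..<n} \<and> length w = inv_num n (word_perm w)"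

lemma some_reduced_word:
  assumes "\<mu> permutes {1..n}"
  shows "reduced_word n (SOME w. reduced_word_for n \<mu> w)"
    and "word_perm (SOME w. reduced_word_for n \<mu> w) = \<mu>"
proof -
  have "\<exists>w. reduced_word_for n \<mu> w"
    using ex_word_of_inv_num_length[OF assms] cox_length_eq_inv_num[OF assms]
    by (auto simp: reduced_word_for_def)
  then have "reduced_word_for n \<mu> (SOME w. reduced_word_for n \<mu> w)" by (rule someI_ex)
  then show "reduced_word n (SOME w. reduced_word_for n \<mu> w)"
      "word_perm (SOME w. reduced_word_for n \<mu> w) = \<mu>"
    using cox_length_eq_inv_num[OF assms]
    by (auto simp: reduced_word_for_def is_word_for_def reduced_word_def)
qed

text \<open>A last letter acting on a descent would leave fewer inversions than letters. So it acts
  on an ascent, and dropping it loses one letter and one inversion.\<close>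

lemma reduced_word_snocD:
  assumes "reduced_word n (w @ [i])"
  shows "reduced_word n w" "i \<in> {1..<n}" "word_perm w i < word_perm w (Suc i)"
proof -
  have w: "set w \<subseteq> {1..<n}" and i: "i \<in> {1..<n}"
    and len: "Suc (length w) = inv_num n (word_perm w \<circ> simple_transp i)"
    using assms word_perm_snoc[of w i] by (auto simp: reduced_word_def)
  have p: "word_perm w permutes {1..n}" by (rule word_perm_permutes[OF w])
  have ne: "word_perm w i \<noteq> word_perm w (Suc i)"
    by (simp add: inj_eq[OF permutes_inj[OF p]])
  show lt: "word_perm w i < word_perm w (Suc i)"
    using ne inv_num_comp_simple_transp(2)[OF p i] len inv_num_word_perm_le[OF w] by fastforce
  show "i \<in> {1..<n}" by (rule i)
  show "reduced_word n w"
    using inv_num_comp_simple_transp(1)[OF p i lt] len w by (simp add: reduced_word_def)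
qed

text \<open>Exchanging two values amounts to exchanging the positions that hold them, which reduces
  left multiplication to the right multiplication already counted.\<close>

lemma simple_transp_comp_eq:
  assumes "inj \<mu>" "\<mu> p = j" "\<mu> q = Suc j"
  shows "simple_transp j \<circ> \<mu> = \<mu> \<circ> transpose p q"
proof
  fix x
  show "(simple_transp j \<circ> \<mu>) x = (\<mu> \<circ> transpose p q) x"
    using assms(2,3) inj_eq[OF assms(1), of x p] inj_eq[OF assms(1), of x q]
    by (cases "x = p"; cases "x = q") (simp_all add: transpose_apply_other)
qed

text \<open>The first letter exchanges two neighbouring values whose positions may be far apart; if
  they stood in the wrong order, it would lower the inversion number.\<close>

lemma reduced_word_ConsD:
  assumes "reduced_word n (i # w)" "word_perm w p = i" "word_perm w q = Suc i"
  shows "reduced_word n w" "i \<in> {1..<n}" "p < q"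
proof -
  have w: "set w \<subseteq> {1..<n}" and i: "i \<in> {1..<n}"
    and len: "Suc (length w) = inv_num n (simple_transp i \<circ> word_perm w)"
    using assms by (auto simp: reduced_word_def)
  have p: "word_perm w permutes {1..n}" by (rule word_perm_permutes[OF w])
  have pq: "p \<in> {1..n}" "q \<in> {1..n}"
    using permutes_in_image[OF p, of p] permutes_in_image[OF p, of q] assms(2,3) i by auto
  have eq: "simple_transp i \<circ> word_perm w = word_perm w \<circ> transpose p q"
    by (rule simple_transp_comp_eq[OF permutes_inj[OF p] assms(2,3)])
  have "p \<noteq> q" using assms(2,3) by auto
  moreover have "\<not> q < p"
  proof
    assume "q < p"
    then have "inv_num n (word_perm w \<circ> transpose q p) < inv_num n (word_perm w)"
      using inv_num_comp_transpose_less_iff[OF p, of q p] pq assms(2,3) by simp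
    then show False using len eq inv_num_word_perm_le[OF w] by (simp add: transpose_commute)
  qed
  ultimately show "p < q" by simp
  show "i \<in> {1..<n}" by (rule i)
  \<comment> \<open>Putting \<open>i\<close> in front of a shortest word for the remaining product
    shows that a letter on the left, too, adds at most one inversion.\<close>
  obtain w' where w': "is_word_for n (word_perm w) w'" "length w' = inv_num n (word_perm w)"
    using ex_word_of_inv_num_length[OF p] by blast
  then have "inv_num n (word_perm (i # w')) \<le> length (i # w')"
    using i by (intro inv_num_word_perm_le) (auto simp: is_word_for_def)
  then have "length w \<le> inv_num n (word_perm w)"
    using w' len by (simp add: is_word_for_def)
  then show "reduced_word n w"
    using w inv_num_word_perm_le[OF w] by (simp add: reduced_word_def)
qed

section \<open>Bruhat transpositions\<close>

definition bruhat_cover :: "(nat \<Rightarrow> nat) \<Rightarrow> nat \<Rightarrow> nat \<Rightarrow> bool" where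
  "bruhat_cover \<mu> a b \<longleftrightarrow> \<mu> a < \<mu> b \<and> (\<forall>c. a < c \<and> c < b \<longrightarrow> \<not> (\<mu> a < \<mu> c \<and> \<mu> c < \<mu> b))"

text \<open>The inversion number of an exchanged ascent grows by one plus twice the number of
  intermediate entries, hence by exactly one when there are none.\<close>

lemma bruhat_transp_iff:
  "bruhat_transp n \<mu> (a, b) \<longleftrightarrow>
     \<mu> permutes {1..n} \<and> 1 \<le> a \<and> a < b \<and> b \<le> n \<and> bruhat_cover \<mu> a b"
proof (cases "1 \<le> a \<and> a < b \<and> b \<le> n")
  case ab: True
  show ?thesis
  proof (cases "\<mu> permutes {1..n}")
    case p: True
    define C where "C = {c. a < c \<and> c < b \<and> \<mu> a < \<mu> c \<and> \<mu> c < \<mu> b}"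
    have "finite C" by (rule finite_subset[of _ "{a..b}"]) (auto simp: C_def)
    have "cox_length n (\<mu> \<circ> transpose a b) = cox_length n \<mu> + 1 \<longleftrightarrow>
        inv_num n (\<mu> \<circ> transpose a b) = inv_num n \<mu> + 1"
      using cox_length_eq_inv_num[OF p] cox_length_eq_inv_num[OF permutes_transpose_comp[OF p, of a b]] ab
      by simp
    also have "\<dots> \<longleftrightarrow> \<mu> a < \<mu> b \<and> C = {}"
    proof (cases "\<mu> a < \<mu> b")
      case True
      then show ?thesis
        using inv_num_comp_transpose[OF p, of a b] ab \<open>finite C\<close> by (simp add: C_def)
    next
      case False
      moreover have "\<mu> a \<noteq> \<mu> b"
        using ab by (simp add: inj_eq[OF permutes_inj[OF p]])
      ultimately show ?thesis
        using inv_num_comp_transpose_less_iff[OF p, of a b] ab by simp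
    qed
    also have "\<dots> \<longleftrightarrow> bruhat_cover \<mu> a b"
      by (auto simp: C_def bruhat_cover_def)
    finally show ?thesis using p ab by (simp add: bruhat_transp_def)
  next
    case False
    \<comment> \<open>Outside the symmetric group no word exists, so \<open>cox_length\<close> takes
      the same default value before and after the exchange and cannot grow by one.\<close>
    have "cox_length n \<nu> = (LEAST m. False)" if "\<not> \<nu> permutes {1..n}" for \<nu>
    proof -
      have "\<not> is_word_for n \<nu> w" for w
        using word_perm_permutes[of w n] that by (auto simp: is_word_for_def)
      then show ?thesis by (simp add: cox_length_def)
    qed
    then have "cox_length n (\<mu> \<circ> transpose a b) = cox_length n \<mu>"
      using False comp_transpose_permutes_iff[of a b n \<mu>] ab by simp
    then show ?thesis using False by (simp add: bruhat_transp_def)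
  qed
qed (auto simp: bruhat_transp_def)

section \<open>Linear maps on the module\<close>

lemma linear_eq_on_frag:
  fixes f g :: "('a \<Rightarrow>\<^sub>0 int) \<Rightarrow> ('b \<Rightarrow>\<^sub>0 int)"
  assumes "\<And>x y. f (x - y) = f x - f y" "\<And>x y. g (x - y) = g x - g y"
    and "\<And>a. f (frag_of a) = g (frag_of a)"
  shows "f x = g x"
proof (induction x rule: frag_induction[OF subset_UNIV])
  case 1
  show ?case using assms(1)[of 0 0] assms(2)[of 0 0] by simp
qed (simp_all add: assms)

lemma pi_op_diff: "pi_op i (x - y) = pi_op i x - pi_op i y"
  by (simp add: pi_op_def frag_extend_diff)

lemma pi_hat_op_diff: "pi_hat_op i (x - y) = pi_hat_op i x - pi_hat_op i y"
  by (simp add: pi_hat_op_def pi_op_diff)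

lemma pi_op_K: "pi_op i (K \<mu>) = K (if \<mu> (Suc i) < \<mu> i then \<mu> \<circ> simple_transp i else \<mu>)"
  by (simp add: pi_op_def)

lemma pi_op_0 [simp]: "pi_op i 0 = 0"
  by (simp add: pi_op_def)

text \<open>Extended by 0 to basis elements \<open>K \<mu>\<close> with \<open>\<mu>\<close> not a permutation, so that it commutes with \<open>pi_op i\<close> everywhere.\<close>

definition left_op :: "nat \<Rightarrow> nat \<Rightarrow> perm_module \<Rightarrow> perm_module" where
  "left_op n j = frag_extend (\<lambda>\<mu>. if \<mu> permutes {1..n}
     then K (if inv \<mu> (Suc j) < inv \<mu> j then simple_transp j \<circ> \<mu> else \<mu>) else 0)"

lemma left_op_diff: "left_op n j (x - y) = left_op n j x - left_op n j y"
  by (simp add: left_op_def frag_extend_diff)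

lemma left_op_0 [simp]: "left_op n j 0 = 0"
  by (simp add: left_op_def)

lemma left_op_K:
  assumes "\<mu> permutes {1..n}" "\<mu> p = j" "\<mu> q = Suc j"
  shows "left_op n j (K \<mu>) = K (if q < p then simple_transp j \<circ> \<mu> else \<mu>)"
proof -
  have "inv \<mu> j = p" "inv \<mu> (Suc j) = q"
    using permutes_inverses(2)[OF assms(1)] assms(2,3) by metis+
  then show ?thesis using assms(1) by (simp add: left_op_def)
qed

lemma simple_transp_comp_permutes:
  assumes "\<mu> permutes {1..n}" "j \<in> {1..<n}"
  shows "simple_transp j \<circ> \<mu> permutes {1..n}"
proof (rule permutes_compose[OF assms(1)])
  show "simple_transp j permutes {1..n}"
    by (rule permutes_swap_id) (use assms(2) in auto)
qed

lemma permutes_obtain_positions: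
  assumes "\<mu> permutes {1..n}" "j \<in> {1..<n}"
  obtains p q where "\<mu> p = j" "\<mu> q = Suc j" "p \<noteq> q" "p \<in> {1..n}" "q \<in> {1..n}"
proof
  show "\<mu> (inv \<mu> j) = j" "\<mu> (inv \<mu> (Suc j)) = Suc j"
    using permutes_inverses(1)[OF assms(1)] by auto
  then show "inv \<mu> j \<noteq> inv \<mu> (Suc j)" by (metis n_not_Suc_n)
  show "inv \<mu> j \<in> {1..n}" "inv \<mu> (Suc j) \<in> {1..n}"
    unfolding permutes_in_image[OF permutes_inv[OF assms(1)]] using assms(2) by auto
qed

text \<open>After one application \<open>j\<close> stands to the left of \<open>Suc j\<close>, a
  situation that the operator fixes.\<close>

lemma left_op_idem:
  assumes "j \<in> {1..<n}"
  shows "left_op n j (left_op n j x) = left_op n j x"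
proof (rule linear_eq_on_frag[where f = "\<lambda>x. left_op n j (left_op n j x)"])
  fix \<mu> :: "nat \<Rightarrow> nat"
  show "left_op n j (left_op n j (K \<mu>)) = left_op n j (K \<mu>)"
  proof (cases "\<mu> permutes {1..n}")
    case True
    from permutes_obtain_positions[OF this assms] obtain p q where
      pq: "\<mu> p = j" "\<mu> q = Suc j" by metis
    show ?thesis
    proof (cases "q < p")
      case lt: True
      have "left_op n j (K (simple_transp j \<circ> \<mu>)) = K (simple_transp j \<circ> \<mu>)"
        using left_op_K[OF simple_transp_comp_permutes[OF True assms], of q j p] pq lt by simp
      then show ?thesis using left_op_K[OF True pq] lt by simp
    next
      case False
      then show ?thesis using left_op_K[OF True pq] by simp
    qed
  qed (simp add: left_op_def)
qed (simp_all add: left_op_diff)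

text \<open>No third value fits between \<open>j\<close> and \<open>Suc j\<close>, so exchanging
  them reverses only their own comparison.\<close>

lemma simple_transp_less_iff:
  assumes "x \<noteq> y" "{x, y} \<noteq> {j, Suc j}"
  shows "simple_transp j x < simple_transp j y \<longleftrightarrow> x < y"
  using assms by (auto simp: transpose_def doubleton_eq_iff)

text \<open>If \<open>j\<close> and \<open>Suc j\<close> occupy the positions \<open>i\<close> and
  \<open>Suc i\<close>, both operators make, or both omit, the same exchange. Otherwise neither
  affects the comparison that the other one tests.\<close>

lemma left_op_pi_op:
  assumes "i \<in> {1..<n}" "j \<in> {1..<n}"
  shows "left_op n j (pi_op i x) = pi_op i (left_op n j x)"
proof (rule linear_eq_on_frag[where f = "\<lambda>x. left_op n j (pi_op i x)"])
  fix \<mu> :: "nat \<Rightarrow> nat"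
  show "left_op n j (pi_op i (K \<mu>)) = pi_op i (left_op n j (K \<mu>))"
  proof (cases "\<mu> permutes {1..n}")
    case True
    from permutes_obtain_positions[OF this assms(2)] obtain p q where
      pq: "\<mu> p = j" "\<mu> q = Suc j" "p \<noteq> q" by metis
    let ?s = "simple_transp i" and ?t = "simple_transp j"
    have \<mu>s: "\<mu> \<circ> ?s permutes {1..n}"
      using True assms(1) by (intro permutes_transpose_comp) auto
    have L: "left_op n j (K \<mu>) = K (if q < p then ?t \<circ> \<mu> else \<mu>)"
      by (rule left_op_K[OF True pq(1,2)])
    have Ls: "left_op n j (K (\<mu> \<circ> ?s)) = K (if ?s q < ?s p then ?t \<circ> (\<mu> \<circ> ?s) else \<mu> \<circ> ?s)"
      by (rule left_op_K[OF \<mu>s]) (simp_all add: pq)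
    have eq: "\<mu> x = j \<longleftrightarrow> x = p" "\<mu> x = Suc j \<longleftrightarrow> x = q" for x
      using inj_eq[OF permutes_inj[OF True], of x p] inj_eq[OF permutes_inj[OF True], of x q]
      by (simp_all only: pq(1,2))
    consider "p = i" "q = Suc i" | "q = i" "p = Suc i" | "{p, q} \<noteq> {i, Suc i}" by (metis doubleton_eq_iff)
    then show ?thesis
    proof cases
      case 1
      then show ?thesis using pq L by (simp add: pi_op_K)
    next
      case 2
      have "?t \<circ> \<mu> = \<mu> \<circ> ?s"
        using simple_transp_comp_eq[OF permutes_inj[OF True] pq(1,2)] 2
        by (simp add: transpose_commute)
      then show ?thesis using pq L Ls 2 by (simp add: pi_op_K)
    next
      case 3
      have a: "?s q < ?s p \<longleftrightarrow> q < p"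
        using 3 pq(3) by (intro simple_transp_less_iff) auto
      have b: "(?t \<circ> \<mu>) (Suc i) < (?t \<circ> \<mu>) i \<longleftrightarrow> \<mu> (Suc i) < \<mu> i"
      proof -
        have "{\<mu> (Suc i), \<mu> i} \<noteq> {j, Suc j}"
          using 3 unfolding doubleton_eq_iff eq by metis
        moreover have "\<mu> (Suc i) \<noteq> \<mu> i"
          by (simp add: inj_eq[OF permutes_inj[OF True]])
        ultimately show ?thesis using simple_transp_less_iff[of "\<mu> (Suc i)" "\<mu> i" j] by simp
      qed
      show ?thesis
        using a b by (simp add: pi_op_K L Ls comp_assoc)
    qed
  \<comment> \<open>For a non-permutation both sides vanish, because exchanging two positions in
    \<open>{1..n}\<close> cannot turn it into a permutation.\<close>
  qed (use assms(1) comp_transpose_permutes_iff[of i "Suc i" n \<mu>] in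
        \<open>auto simp: left_op_def pi_op_K\<close>)
qed (simp_all add: left_op_diff pi_op_diff)

lemma left_op_pi_hat_op:
  assumes "i \<in> {1..<n}" "j \<in> {1..<n}"
  shows "left_op n j (pi_hat_op i x) = pi_hat_op i (left_op n j x)"
  by (simp add: pi_hat_op_def left_op_diff left_op_pi_op[OF assms])

section \<open>Products of factors \<open>1 - \<tau>\<close>\<close>

definition dot_prod :: "nat \<Rightarrow> (nat \<times> nat) list \<Rightarrow> perm_module \<Rightarrow> perm_module" where
  "dot_prod n L x = foldl (\<lambda>x \<tau>. x - dot_transp n \<tau> x) x L"

lemma dot_transp_diff: "dot_transp n \<tau> (x - y) = dot_transp n \<tau> x - dot_transp n \<tau> y"
  by (simp add: dot_transp_def frag_extend_diff)

lemma dot_prod_Nil [simp]: "dot_prod n [] x = x"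
  by (simp add: dot_prod_def)

lemma dot_prod_Cons: "dot_prod n (\<tau> # L) x = dot_prod n L (x - dot_transp n \<tau> x)"
  by (simp add: dot_prod_def)

lemma dot_prod_diff: "dot_prod n L (x - y) = dot_prod n L x - dot_prod n L y"
proof (induction L arbitrary: x y)
  case (Cons \<tau> L)
  have "x - y - dot_transp n \<tau> (x - y) = (x - dot_transp n \<tau> x) - (y - dot_transp n \<tau> y)"
    by (simp add: dot_transp_diff)
  then show ?case by (simp only: dot_prod_Cons Cons)
qed simp

lemma dot_prod_Cons_K:
  "dot_prod n ((a, b) # L) (K \<mu>) =
    (if bruhat_transp n \<mu> (a, b) then dot_prod n L (K \<mu>) - dot_prod n L (K (\<mu> \<circ> transpose a b))
     else dot_prod n L (K \<mu>))"
  using dot_prod_diff[of n L 0 0] by (simp add: dot_prod_Cons dot_transp_def dot_prod_diff)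

text \<open>The order refers to positions only, so one and the same list serves every permutation
  met in the recursion.\<close>

definition lex_prec :: "nat \<times> nat \<Rightarrow> nat \<times> nat \<Rightarrow> bool" where
  "lex_prec = (\<lambda>(a, b) (a', b'). a < a' \<or> (a = a' \<and> b' < b))"

text \<open>The final segments of the lexicographic list of all pairs: the invariant for an
  induction that strips off the first factor.\<close>

definition lex_tail :: "nat \<Rightarrow> nat \<Rightarrow> (nat \<times> nat) list \<Rightarrow> bool" where
  "lex_tail n k L \<longleftrightarrow> sorted_wrt lex_prec L \<and> set L \<subseteq> {1..k} \<times> {k<..n} \<and>
     (\<forall>x\<in>set L. \<forall>y\<in>{1..k} \<times> {k<..n}. lex_prec x y \<longrightarrow> y \<in> set L)"

text \<open>Sortedness puts the rest of the list after \<open>x\<close>, and closure puts every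
  later pair into it. Whether a factor is still to come thus becomes an inequality of
  positions.\<close>

lemma lex_tail_ConsD:
  assumes "lex_tail n k (x # L)"
  shows "lex_tail n k L" "x \<in> {1..k} \<times> {k<..n}"
    "y \<in> set L \<longleftrightarrow> y \<in> {1..k} \<times> {k<..n} \<and> lex_prec x y"
proof -
  have irr: "\<not> lex_prec z z" for z by (auto simp: lex_prec_def)
  have asym: "lex_prec z w \<Longrightarrow> \<not> lex_prec w z" for z w by (auto simp: lex_prec_def)
  have L: "sorted_wrt lex_prec L" "\<And>z. z \<in> set L \<Longrightarrow> lex_prec x z"
      "x \<in> {1..k} \<times> {k<..n}" "set L \<subseteq> {1..k} \<times> {k<..n}"
    using assms unfolding lex_tail_def by simp_all
  have up: "z \<in> set (x # L)" if "w \<in> set (x # L)" "z \<in> {1..k} \<times> {k<..n}" "lex_prec w z" for w z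
    using assms that unfolding lex_tail_def by metis
  show "x \<in> {1..k} \<times> {k<..n}" by (rule L)
  have mem: "z \<in> set L \<longleftrightarrow> z \<in> {1..k} \<times> {k<..n} \<and> lex_prec x z" for z
  proof
    assume "z \<in> {1..k} \<times> {k<..n} \<and> lex_prec x z"
    then have "z \<in> set (x # L)" "z \<noteq> x" using up[of x z] irr[of x] by auto
    then show "z \<in> set L" by simp
  qed (use L in blast)
  show "y \<in> set L \<longleftrightarrow> y \<in> {1..k} \<times> {k<..n} \<and> lex_prec x y" by (rule mem)
  have "z \<in> set L" if "w \<in> set L" "z \<in> {1..k} \<times> {k<..n}" "lex_prec w z" for w z
  proof -
    have "z \<in> set (x # L)" using up[of w z] that by simp
    moreover have "z \<noteq> x" using asym[of w x] L(2)[OF that(1)] that(3) by auto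
    ultimately show ?thesis by simp
  qed
  then show "lex_tail n k L" unfolding lex_tail_def using L(1,4) by blast
qed

section \<open>The left recursion for the full product\<close>

lemma simple_transp_comp_less_iff:
  assumes "inj \<mu>" "\<mu> p = j" "\<mu> q = Suc j" "{x, y} \<noteq> {p, q}"
  shows "simple_transp j (\<mu> x) < simple_transp j (\<mu> y) \<longleftrightarrow> \<mu> x < \<mu> y"
proof (cases "x = y")
  case False
  have eq: "\<mu> x = j \<longleftrightarrow> x = p" "\<mu> x = Suc j \<longleftrightarrow> x = q" for x
    using inj_eq[OF assms(1), of x p] inj_eq[OF assms(1), of x q] by (simp_all only: assms(2,3))
  have "\<mu> x \<noteq> \<mu> y" using inj_eq[OF assms(1)] False by simp
  moreover have "{\<mu> x, \<mu> y} \<noteq> {j, Suc j}"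
    using assms(4) unfolding doubleton_eq_iff eq by metis
  ultimately show ?thesis by (rule simple_transp_less_iff)
qed simp

text \<open>Passing from \<mu> to s_j \<mu> changes only the comparison of \<open>p\<close> with
  \<open>q\<close>. Trouble could arise only if \<open>a = p\<close> and \<open>q < b\<close>, or
  \<open>b = q\<close> and \<open>a < p\<close>, and the cover itself excludes both.\<close>

lemma bruhat_cover_left_mult:
  assumes "inj \<mu>" "p < q" "\<mu> p = j" "\<mu> q = Suc j" "a < b" "(a, b) \<noteq> (p, q)"
    and "bruhat_cover \<mu> a b"
  shows "bruhat_cover (simple_transp j \<circ> \<mu>) a b" "transpose a b p < transpose a b q"
proof -
  have eq: "\<mu> x = j \<longleftrightarrow> x = p" "\<mu> x = Suc j \<longleftrightarrow> x = q" for x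
    using inj_eq[OF assms(1), of x p] inj_eq[OF assms(1), of x q] by (simp_all only: assms(3,4))
  note less = simple_transp_comp_less_iff[OF assms(1,3,4)]
  have cov: "\<mu> a < \<mu> b" "\<And>c. a < c \<Longrightarrow> c < b \<Longrightarrow> \<not> (\<mu> a < \<mu> c \<and> \<mu> c < \<mu> b)"
    using assms(7) by (auto simp: bruhat_cover_def)
  have ne: "{a, b} \<noteq> {p, q}" using assms(2,5,6) by (auto simp: doubleton_eq_iff)
  \<comment> \<open>In the first configuration the value \<open>Suc j\<close> at \<open>q\<close>,
    in the second the value \<open>j\<close> at \<open>p\<close>, would obstruct the cover.\<close>
  have ord: "\<not> (a = p \<and> q < b)" "\<not> (b = q \<and> a < p)"
  proof -
    show "\<not> (a = p \<and> q < b)"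
    proof
      assume *: "a = p \<and> q < b"
      then have "\<mu> b \<noteq> j" "\<mu> b \<noteq> Suc j" using eq assms(2) by auto
      then show False using cov(1) cov(2)[of q] * assms(2-4) by auto
    qed
    show "\<not> (b = q \<and> a < p)"
    proof
      assume *: "b = q \<and> a < p"
      then have "\<mu> a \<noteq> j" "\<mu> a \<noteq> Suc j" using eq assms(2) by auto
      then show False using cov(1) cov(2)[of p] * assms(2-4) by auto
    qed
  qed
  show "transpose a b p < transpose a b q"
    using ord assms(2,5,6) by (auto simp: transpose_def)
  show "bruhat_cover (simple_transp j \<circ> \<mu>) a b"
    unfolding bruhat_cover_def o_apply
  proof (intro conjI allI impI)
    show "simple_transp j (\<mu> a) < simple_transp j (\<mu> b)"
      using less[OF ne] cov(1) by simp
    fix c assume c: "a < c \<and> c < b"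
    show "\<not> (simple_transp j (\<mu> a) < simple_transp j (\<mu> c) \<and> simple_transp j (\<mu> c) < simple_transp j (\<mu> b))"
    proof (cases "{a, c} = {p, q} \<or> {c, b} = {p, q}")
      case True
      then have "a = p \<and> c = q \<or> c = p \<and> b = q"
        using c assms(2) by (auto simp: doubleton_eq_iff)
      then show ?thesis using ord c by auto
    next
      case False
      then show ?thesis using less[of a c] less[of c b] cov(2)[of c] c by simp
    qed
  qed
qed

text \<open>Only a changed comparison of \<open>p\<close> with \<open>q\<close> can create a cover.
  This happens when one of these positions obstructs the pair in \<mu> and its value leaves the
  interval in s_j \<mu>.\<close>

lemma bruhat_cover_left_mult_new:
  assumes "inj \<mu>" "p < q" "\<mu> p = j" "\<mu> q = Suc j" "a < b"
    and "bruhat_cover (simple_transp j \<circ> \<mu>) a b" "\<not> bruhat_cover \<mu> a b"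
  shows "b = q \<and> a < p \<or> a = p \<and> q < b"
proof (rule ccontr)
  assume not: "\<not> (b = q \<and> a < p \<or> a = p \<and> q < b)"
  note less = simple_transp_comp_less_iff[OF assms(1,3,4)]
  have cov: "simple_transp j (\<mu> a) < simple_transp j (\<mu> b)"
      "\<And>c. a < c \<Longrightarrow> c < b \<Longrightarrow>
        \<not> (simple_transp j (\<mu> a) < simple_transp j (\<mu> c) \<and> simple_transp j (\<mu> c) < simple_transp j (\<mu> b))"
    using assms(6) by (auto simp: bruhat_cover_def)
  have "{a, b} \<noteq> {p, q}"
    using cov(1) assms(2-5) by (auto simp: doubleton_eq_iff)
  then have "\<mu> a < \<mu> b" using less cov(1) by blast
  moreover have "\<not> (\<mu> a < \<mu> c \<and> \<mu> c < \<mu> b)" if c: "a < c" "c < b" for c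
  proof -
    have "{a, c} \<noteq> {p, q}" "{c, b} \<noteq> {p, q}"
      using not c assms(2) by (auto simp: doubleton_eq_iff)
    then show ?thesis using less[of a c] less[of c b] cov(2)[OF c] by blast
  qed
  ultimately show False using assms(7) by (simp add: bruhat_cover_def)
qed

text \<open>
  The delicate step is a first factor \<open>(a, b) \<noteq> (p, q)\<close> that is a Bruhat transposition of \<open>s\<^sub>j \<mu>\<close> but not
  of \<open>\<mu>\<close>. The extra term then has \<open>j\<close> and \<open>j + 1\<close> at the positions \<open>(a, p)\<close> or \<open>(q, b)\<close>, and exactly one of
  that pair and \<open>(p, q)\<close> is still to come; this is what makes the extra term cancel.
\<close>

lemma dot_prod_left_op:
  assumes "lex_tail n k L" "\<mu> permutes {1..n}" "j \<in> {1..<n}" "\<mu> p = j" "\<mu> q = Suc j" "p < q"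
  shows "dot_prod n L (K \<mu>) = left_op n j (dot_prod n L (K (simple_transp j \<circ> \<mu>)))
    - (if (p, q) \<in> set L then dot_prod n L (K (simple_transp j \<circ> \<mu>)) else 0)"
  using assms
proof (induction L arbitrary: \<mu> p q)
  case Nil
  have *: "left_op n j (K (simple_transp j \<circ> \<mu>)) = K \<mu>"
    using left_op_K[OF simple_transp_comp_permutes[OF Nil.prems(2,3)], of q j p] Nil.prems
    by (simp flip: comp_assoc)
  show ?case unfolding dot_prod_Nil * by simp
next
  case (Cons x L)
  obtain a b where x: "x = (a, b)" by (cases x)
  note p\<mu> = Cons.prems(2) and j = Cons.prems(3) and pq = Cons.prems(4-6)
  let ?t = "simple_transp j"
  let ?\<nu> = "?t \<circ> \<mu>" and ?D = "dot_prod n L" and ?lam = "left_op n j"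
  note tl = lex_tail_ConsD[OF Cons.prems(1)]
  have ab: "1 \<le> a" "a \<le> k" "k < b" "b \<le> n" "a < b" using tl(2) x by auto
  have "p \<in> {1..n}" "q \<in> {1..n}"
    using permutes_in_image[OF p\<mu>, of p] permutes_in_image[OF p\<mu>, of q] pq(1,2) j by auto
  then have pqn: "1 \<le> p" "q \<le> n" by auto
  have mem: "(c, d) \<in> set L \<longleftrightarrow> 1 \<le> c \<and> c \<le> k \<and> k < d \<and> d \<le> n \<and> (a < c \<or> a = c \<and> d < b)" for c d
    by (auto simp: tl(3) x lex_prec_def)
  have IH: "?D (K \<rho>) = ?lam (?D (K (?t \<circ> \<rho>))) - (if (c, d) \<in> set L then ?D (K (?t \<circ> \<rho>)) else 0)"
    if "\<rho> permutes {1..n}" "\<rho> c = j" "\<rho> d = Suc j" "c < d" for \<rho> c d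
    using Cons.IH[OF tl(1) that(1) j that(2-4)] .
  \<comment> \<open>By idempotence the induction hypothesis shows that a product with
    \<open>j\<close> left of \<open>Suc j\<close> is killed by \<open>left_op\<close> if their pair
    is still to come, and fixed if not.\<close>
  have IH': "?lam (?D (K \<rho>)) = (if (c, d) \<in> set L then 0 else ?D (K \<rho>))"
    if "\<rho> permutes {1..n}" "\<rho> c = j" "\<rho> d = Suc j" "c < d" for \<rho> c d
    using IH[OF that] by (simp add: left_op_diff left_op_idem[OF j])
  have p\<nu>: "?\<nu> permutes {1..n}" by (rule simple_transp_comp_permutes[OF p\<mu> j])
  have bt: "bruhat_transp n \<mu> (a, b) \<longleftrightarrow> bruhat_cover \<mu> a b"
      "bruhat_transp n ?\<nu> (a, b) \<longleftrightarrow> bruhat_cover ?\<nu> a b"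
    unfolding bruhat_transp_iff using p\<mu> p\<nu> ab by blast+
  have DC: "dot_prod n (x # L) (K \<rho>) =
     (if bruhat_transp n \<rho> (a, b) then ?D (K \<rho>) - ?D (K (\<rho> \<circ> transpose a b)) else ?D (K \<rho>))" for \<rho>
    unfolding x by (rule dot_prod_Cons_K)
  show ?case
  proof (cases "(a, b) = (p, q)")
    case True
    \<comment> \<open>This factor is a cover for \<mu> only, and the exchange yields s_j \<mu>: it
      produces the subtracted term, while the tail no longer contains the pair and needs no
      correction.\<close>
    then have [simp]: "p = a" "q = b" by auto
    have "bruhat_cover \<mu> a b" using pq by (auto simp: bruhat_cover_def)
    moreover have "\<not> bruhat_cover ?\<nu> a b" using pq by (auto simp: bruhat_cover_def)
    moreover have "?\<nu> = \<mu> \<circ> transpose a b"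
      using simple_transp_comp_eq[OF permutes_inj[OF p\<mu>] pq(1,2)] by simp
    moreover have "(a, b) \<notin> set L" by (simp add: mem)
    ultimately show ?thesis
      using IH[OF p\<mu> pq] unfolding DC bt by (simp add: x)
  next
    case ne: False
    then have mem1: "(p, q) \<in> set (x # L) \<longleftrightarrow> (p, q) \<in> set L"
      by (auto simp: x)
    show ?thesis
    proof (cases "bruhat_cover \<mu> a b")
      case True
      note cov = bruhat_cover_left_mult[OF permutes_inj[OF p\<mu>] pq(3,1,2) ab(5) ne True]
      let ?\<rho> = "\<mu> \<circ> transpose a b"
      have \<rho>: "?\<rho> permutes {1..n}" using permutes_transpose_comp[OF p\<mu> ab(1,5,4)] .
      \<comment> \<open>The exchange may move \<open>j\<close> and \<open>Suc j\<close>. If it does,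
        neither the old nor the new pair of positions lies in the tail; if it does not, the pair is
        the same.\<close>
      have "(transpose a b p, transpose a b q) \<in> set L \<longleftrightarrow> (p, q) \<in> set L"
      proof -
        consider "a = p" "b \<noteq> q" | "a = q" | "b = p" | "a \<noteq> p" "b = q"
          | "p \<noteq> a" "p \<noteq> b" "q \<noteq> a" "q \<noteq> b"
          using ne by metis
        then show ?thesis
        proof cases
          case 1
          then have "b < q" using cov(2) pq(3) by simp
          then show ?thesis using 1 pq(3) ab by (simp add: mem)
        next
          case 2
          then show ?thesis using pq(3) ab by (simp add: mem)
        next
          case 3
          then show ?thesis using pq(3) ab by (simp add: mem)
        next
          case 4
          then have "p < a" using cov(2) pq(3) ab by (simp add: transpose_def split: if_splits)
          then show ?thesis using 4 pq(3) ab by (simp add: mem transpose_def)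
        next
          case 5
          then show ?thesis by simp
        qed
      qed
      then have "?D (K ?\<rho>) = ?lam (?D (K (?\<nu> \<circ> transpose a b)))
          - (if (p, q) \<in> set L then ?D (K (?\<nu> \<circ> transpose a b)) else 0)"
        using IH[OF \<rho>, of "transpose a b p" "transpose a b q"] cov(2) pq(1,2)
        by (simp add: comp_assoc del: o_apply) (simp add: comp_def)
      then show ?thesis
        using IH[OF p\<mu> pq] True cov(1) unfolding DC bt mem1 by (simp add: left_op_diff)
    next
      case False
      show ?thesis
      proof (cases "bruhat_cover ?\<nu> a b")
        case True
        let ?\<rho> = "?\<nu> \<circ> transpose a b"
        have \<rho>: "?\<rho> permutes {1..n}" using permutes_transpose_comp[OF p\<nu> ab(1,5,4)] .
        have "?lam (?D (K ?\<rho>)) = (if (p, q) \<in> set L then ?D (K ?\<rho>) else 0)"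
          using bruhat_cover_left_mult_new[OF permutes_inj[OF p\<mu>] pq(3,1,2) ab(5) True False]
        proof
          assume *: "b = q \<and> a < p"
          then have "?\<rho> a = j" "?\<rho> p = Suc j" using pq by auto
          \<comment> \<open>The side of \<open>p\<close> decides: for p \<le> k the pair
            \<open>(p, q)\<close> is still to come, for \<open>k < p\<close> it is
            \<open>(a, p)\<close>. In the other case \<open>q\<close> decides in the same
            way.\<close>
          moreover have "(a, p) \<in> set L \<longleftrightarrow> (p, q) \<notin> set L" using * ab pq pqn by (auto simp: mem)
          ultimately show ?thesis using IH'[OF \<rho>, of a p] * by simp
        next
          assume *: "a = p \<and> q < b"
          then have "?\<rho> q = j" "?\<rho> b = Suc j" using pq by auto
          moreover have "(q, b) \<in> set L \<longleftrightarrow> (p, q) \<notin> set L" using * ab pq pqn by (auto simp: mem)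
          ultimately show ?thesis using IH'[OF \<rho>, of q b] * by simp
        qed
        then show ?thesis
          using IH[OF p\<mu> pq] True False unfolding DC bt mem1 by (simp add: left_op_diff)
      next
        case not: False
        then show ?thesis
          using IH[OF p\<mu> pq] False unfolding DC bt mem1 by simp
      qed
    qed
  qed
qed

section \<open>Reordering the factors\<close>

lemma bruhat_cover_between:
  assumes "inj \<mu>" "bruhat_cover \<mu> a b" "a < c" "c < b"
  shows "\<mu> c < \<mu> a \<or> \<mu> b < \<mu> c"
proof -
  have "\<mu> c \<noteq> \<mu> a" "\<mu> c \<noteq> \<mu> b" using assms(3,4) by (simp_all add: inj_eq[OF assms(1)])
  then show ?thesis using assms(2-4) unfolding bruhat_cover_def by (metis linorder_neqE_nat)
qed

text \<open>Each exchange alters the values at its own two positions only, so reversing the order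
  could fail only through an obstruction there. Every such placement contradicts one of the two
  given covers.\<close>

lemma bruhat_cover_disjoint:
  assumes "inj \<mu>" "a < b" "c < d" "a \<noteq> c" "a \<noteq> d" "b \<noteq> c" "b \<noteq> d"
    and cov: "bruhat_cover \<mu> a b" "bruhat_cover (\<mu> \<circ> transpose a b) c d"
  shows "bruhat_cover \<mu> c d" "bruhat_cover (\<mu> \<circ> transpose c d) a b"
proof -
  let ?\<nu> = "\<mu> \<circ> transpose a b" and ?\<rho> = "\<mu> \<circ> transpose c d"
  have val: "?\<nu> a = \<mu> b" "?\<nu> b = \<mu> a" "?\<nu> c = \<mu> c" "?\<nu> d = \<mu> d"
    using assms(4-7) by simp_all
  have "inj ?\<nu>" using assms(1) by (intro inj_compose) simp_all
  note between = bruhat_cover_between[OF assms(1) cov(1)]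
  note between' = bruhat_cover_between[OF \<open>inj ?\<nu>\<close> cov(2), unfolded val]
  have lt: "\<mu> a < \<mu> b" "\<mu> c < \<mu> d"
    using cov unfolding bruhat_cover_def val by simp_all
  have other: "\<mu> e < \<mu> c \<or> \<mu> d < \<mu> e" if "e \<noteq> a" "e \<noteq> b" "c < e" "e < d" for e
    using between'[of e] that by (simp add: transpose_apply_other)
  have a: "\<mu> b < \<mu> c \<or> \<mu> d < \<mu> b" if "c < a" "a < d"
    using between'[OF that] unfolding val .
  have b: "\<mu> a < \<mu> c \<or> \<mu> d < \<mu> a" if "c < b" "b < d"
    using between'[OF that] unfolding val .
  show "bruhat_cover \<mu> c d"
    unfolding bruhat_cover_def
  proof (intro conjI allI impI lt notI)
    fix e assume e: "c < e \<and> e < d" and v: "\<mu> c < \<mu> e \<and> \<mu> e < \<mu> d"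
    consider "e = a" | "e = b" | "e \<noteq> a" "e \<noteq> b" by metis
    then show False
    proof cases
      case 1
      then have "c < a" "a < d" "\<mu> c < \<mu> a" "\<mu> a < \<mu> d" using e v by simp_all
      \<comment> \<open>After the first exchange \<open>a\<close> holds the larger value \<mu> b,
        which must therefore exceed \<mu> d. Then \<open>b\<close> obstructs the second cover if
        \<open>b < d\<close>, and \<open>d\<close> obstructs the first if
        \<open>d < b\<close>.\<close>
      then have "\<mu> d < \<mu> b" using a lt by linarith
      show False
      proof (cases "b < d")
        case True
        then show False using b \<open>c < a\<close> \<open>a < b\<close> \<open>\<mu> c < \<mu> a\<close> \<open>\<mu> a < \<mu> d\<close> by linarith
      next
        case False
        then have "d < b" using assms(7) by simp
        then show False using between[of d] \<open>a < d\<close> \<open>\<mu> a < \<mu> d\<close> \<open>\<mu> d < \<mu> b\<close> by linarith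
      qed
    next
      case 2
      then have "c < b" "b < d" "\<mu> c < \<mu> b" "\<mu> b < \<mu> d" using e v by simp_all
      then have "\<mu> a < \<mu> c" using b lt by linarith
      show False
      proof (cases "c < a")
        case True
        then show False using a \<open>b < d\<close> assms(2) \<open>\<mu> c < \<mu> b\<close> \<open>\<mu> b < \<mu> d\<close> by linarith
      next
        case False
        then have "a < c" using assms(4) by simp
        then show False using between[of c] \<open>c < b\<close> \<open>\<mu> a < \<mu> c\<close> \<open>\<mu> c < \<mu> b\<close> by linarith
      qed
    next
      case 3
      then show False using e v other[of e] by linarith
    qed
  qed
  show "bruhat_cover ?\<rho> a b"
    unfolding bruhat_cover_def
  proof (intro conjI allI impI notI)
    have val: "?\<rho> a = \<mu> a" "?\<rho> b = \<mu> b" "?\<rho> c = \<mu> d" "?\<rho> d = \<mu> c"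
      using assms(4-7) by simp_all
    show "?\<rho> a < ?\<rho> b" unfolding val by (rule lt)
    fix e assume e: "a < e \<and> e < b" and "?\<rho> a < ?\<rho> e \<and> ?\<rho> e < ?\<rho> b"
    then have v: "\<mu> a < ?\<rho> e" "?\<rho> e < \<mu> b" unfolding val by simp_all
    consider "e = c" | "e = d" | "e \<noteq> c" "e \<noteq> d" by metis
    then show False
    proof cases
      case 1
      then have *: "a < c" "c < b" "\<mu> a < \<mu> d" "\<mu> d < \<mu> b" using e v by (simp_all add: val del: o_apply)
      then have "\<mu> c < \<mu> a" using between[of c] lt by linarith
      show False
      proof (cases "d < b")
        case True
        then show False using between[of d] * assms(3) by linarith
      next
        case False
        then have "b < d" using assms(7) by simp
        then show False using b * \<open>\<mu> c < \<mu> a\<close> by linarith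
      qed
    next
      case 2
      then have *: "a < d" "d < b" "\<mu> a < \<mu> c" "\<mu> c < \<mu> b" using e v by (simp_all add: val del: o_apply)
      then have "\<mu> b < \<mu> d" using between[of d] lt by linarith
      show False
      proof (cases "a < c")
        case True
        then show False using between[of c] * assms(3) by linarith
      next
        case False
        then have "c < a" using assms(4) by simp
        then show False using a * \<open>\<mu> b < \<mu> d\<close> by linarith
      qed
    next
      case 3
      then have "?\<rho> e = \<mu> e" by (simp add: transpose_apply_other)
      then show False using e v between[of e] by linarith
    qed
  qed
qed

text \<open>After the first exchange \<open>a\<close> holds \<mu> b'. The first cover excludes
  intermediate values below \<mu> b', the second those above it; together they clear the interval
  from \<mu> a to \<mu> b.\<close>

lemma bruhat_cover_same_fst:
  assumes "inj \<mu>" "a < b" "b < b'" and cov: "bruhat_cover \<mu> a b'" "bruhat_cover (\<mu> \<circ> transpose a b') a b"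
  shows "bruhat_cover \<mu> a b"
proof -
  have lt: "\<mu> a < \<mu> b'" "\<mu> b' < \<mu> b" using cov assms(2,3) by (auto simp: bruhat_cover_def)
  have "\<not> (\<mu> a < \<mu> e \<and> \<mu> e < \<mu> b)" if e: "a < e" "e < b" for e
  proof -
    have "\<not> (\<mu> b' < \<mu> e \<and> \<mu> e < \<mu> b)" using cov(2) e assms(2,3) unfolding bruhat_cover_def by force
    then show ?thesis
      using bruhat_cover_between[OF assms(1) cov(1), of e] e assms(3) by linarith
  qed
  then show ?thesis using lt unfolding bruhat_cover_def by (metis less_trans)
qed

lemma bruhat_cover_same_snd:
  assumes "inj \<mu>" "a' < a" "a < b" and cov: "bruhat_cover \<mu> a' b" "bruhat_cover (\<mu> \<circ> transpose a' b) a b"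
  shows "bruhat_cover \<mu> a b"
proof -
  have lt: "\<mu> a < \<mu> a'" "\<mu> a' < \<mu> b" using cov assms(2,3) by (auto simp: bruhat_cover_def)
  have "\<not> (\<mu> a < \<mu> e \<and> \<mu> e < \<mu> b)" if e: "a < e" "e < b" for e
  proof -
    have "\<not> (\<mu> a < \<mu> e \<and> \<mu> e < \<mu> a')" using cov(2) e assms(2,3) unfolding bruhat_cover_def by force
    then show ?thesis
      using bruhat_cover_between[OF assms(1) cov(1), of e] e assms(2) by linarith
  qed
  then show ?thesis using lt unfolding bruhat_cover_def by (metis less_trans)
qed

text \<open>First entries are at most \<open>k\<close> and second entries exceed it, so two pairs
  are disjoint or share an entry in the same place. In each case the earlier exchange creates no new
  cover at the later pair.\<close>

lemma bruhat_transp_lex_later: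
  assumes "a \<le> k" "k < b" "a' \<le> k" "k < b'" "lex_prec (a, b) (a', b')"
    and "bruhat_transp n \<mu> (a, b)" "bruhat_transp n (\<mu> \<circ> transpose a b) (a', b')"
  shows "bruhat_transp n \<mu> (a', b')"
proof -
  have \<mu>: "\<mu> permutes {1..n}" and cov: "bruhat_cover \<mu> a b" "bruhat_cover (\<mu> \<circ> transpose a b) a' b'"
    and n: "1 \<le> a'" "a' < b'" "b' \<le> n"
    using assms(6,7) unfolding bruhat_transp_iff by simp_all
  note inj = permutes_inj[OF \<mu>]
  have "bruhat_cover \<mu> a' b'"
  proof (cases "a = a'")
    case True
    then have "b' < b" using assms(5) by (simp add: lex_prec_def)
    then show ?thesis using bruhat_cover_same_fst[OF inj n(2)] cov True by simp
  next
    case False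
    then have a: "a < a'" using assms(5) by (simp add: lex_prec_def)
    show ?thesis
    proof (cases "b = b'")
      case True
      then show ?thesis using bruhat_cover_same_snd[OF inj a n(2)] cov by simp
    next
      case False
      then show ?thesis
        using bruhat_cover_disjoint(1)[OF inj _ n(2) _ _ _ _ cov] a assms(1-4) by simp
    qed
  qed
  then show ?thesis using \<mu> n by (simp add: bruhat_transp_iff)
qed

text \<open>Exchanges create no covers at later pairs, so a factor that is not a cover of \<mu> acts
  trivially on every term it meets. Keeping \<open>S\<close> fixed lets the hypothesis pass to the
  exchanged permutation.\<close>

lemma dot_prod_filter:
  assumes "sorted_wrt lex_prec L" "set L \<subseteq> {1..k} \<times> {k<..n}"
    and "\<And>\<tau>. \<tau> \<in> set L \<Longrightarrow> \<tau> \<notin> S \<Longrightarrow> \<not> bruhat_transp n \<mu> \<tau>"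
  shows "dot_prod n L (K \<mu>) = dot_prod n (filter (\<lambda>\<tau>. \<tau> \<in> S) L) (K \<mu>)"
  using assms
proof (induction L arbitrary: \<mu>)
  case (Cons x L)
  obtain a b where x: "x = (a, b)" by (cases x)
  have IH: "dot_prod n L (K \<nu>) = dot_prod n (filter (\<lambda>\<tau>. \<tau> \<in> S) L) (K \<nu>)"
    if "\<And>\<tau>. \<tau> \<in> set L \<Longrightarrow> \<tau> \<notin> S \<Longrightarrow> \<not> bruhat_transp n \<nu> \<tau>" for \<nu>
    by (rule Cons.IH) (use Cons.prems(1,2) that in auto)
  have IH\<mu>: "dot_prod n L (K \<mu>) = dot_prod n (filter (\<lambda>\<tau>. \<tau> \<in> S) L) (K \<mu>)"
    by (rule IH) (use Cons.prems(3) in simp)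
  show ?case
  proof (cases "bruhat_transp n \<mu> x")
    case True
    then have "x \<in> S" using Cons.prems(3)[of x] by auto
    have "dot_prod n L (K (\<mu> \<circ> transpose a b)) = dot_prod n (filter (\<lambda>\<tau>. \<tau> \<in> S) L) (K (\<mu> \<circ> transpose a b))"
    proof (rule IH)
      fix \<tau> assume \<tau>: "\<tau> \<in> set L" "\<tau> \<notin> S"
      obtain a' b' where \<tau>_eq: "\<tau> = (a', b')" by (cases \<tau>)
      have "lex_prec (a, b) (a', b')" using Cons.prems(1) \<tau>(1) by (simp add: x \<tau>_eq)
      moreover have "\<not> bruhat_transp n \<mu> (a', b')" using Cons.prems(3)[of \<tau>] \<tau> \<tau>_eq by simp
      moreover have "a \<le> k" "k < b" "a' \<le> k" "k < b'" using Cons.prems(2) \<tau>(1) by (auto simp: x \<tau>_eq)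
      ultimately show "\<not> bruhat_transp n (\<mu> \<circ> transpose a b) \<tau>"
        using bruhat_transp_lex_later True unfolding x \<tau>_eq by metis
    qed
    then show ?thesis using True \<open>x \<in> S\<close> IH\<mu> unfolding x by (simp add: dot_prod_Cons_K)
  next
    case False
    then show ?thesis using IH\<mu> unfolding x by (simp add: dot_prod_Cons_K)
  qed
qed simp

lemma dot_transp_K:
  "dot_transp n (a, b) (K \<mu>) = (if bruhat_transp n \<mu> (a, b) then K (\<mu> \<circ> transpose a b) else 0)"
  by (simp add: dot_transp_def)

lemma dot_transp_0 [simp]: "dot_transp n \<tau> 0 = 0"
  by (simp add: dot_transp_def)

lemma bruhat_transp_disjoint:
  assumes "a \<noteq> c" "a \<noteq> d" "b \<noteq> c" "b \<noteq> d"
  shows "bruhat_transp n \<mu> (a, b) \<and> bruhat_transp n (\<mu> \<circ> transpose a b) (c, d) \<longleftrightarrow>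
    bruhat_transp n \<mu> (c, d) \<and> bruhat_transp n (\<mu> \<circ> transpose c d) (a, b)"
proof -
  have *: "bruhat_transp n \<mu> (c, d) \<and> bruhat_transp n (\<mu> \<circ> transpose c d) (a, b)"
    if "a \<noteq> c" "a \<noteq> d" "b \<noteq> c" "b \<noteq> d"
      "bruhat_transp n \<mu> (a, b)" "bruhat_transp n (\<mu> \<circ> transpose a b) (c, d)" for a b c d
  proof -
    have \<mu>: "\<mu> permutes {1..n}" and ab: "1 \<le> a" "a < b" "b \<le> n" and cd: "1 \<le> c" "c < d" "d \<le> n"
      and cov: "bruhat_cover \<mu> a b" "bruhat_cover (\<mu> \<circ> transpose a b) c d"
      using that(5,6) unfolding bruhat_transp_iff by simp_all
    show ?thesis
      using bruhat_cover_disjoint[OF permutes_inj[OF \<mu>] ab(2) cd(2) that(1-4) cov]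
        \<mu> ab cd permutes_transpose_comp[OF \<mu> cd] unfolding bruhat_transp_iff by simp
  qed
  show ?thesis using *[of a c d b] *[of c a b d] assms by metis
qed

lemma dot_transp_commute:
  assumes "a \<noteq> c" "a \<noteq> d" "b \<noteq> c" "b \<noteq> d"
  shows "dot_transp n (c, d) (dot_transp n (a, b) x) = dot_transp n (a, b) (dot_transp n (c, d) x)"
proof (rule linear_eq_on_frag[where f = "\<lambda>x. dot_transp n (c, d) (dot_transp n (a, b) x)"])
  fix \<mu> :: "nat \<Rightarrow> nat"
  have "transpose a b \<circ> transpose c d = transpose c d \<circ> transpose a b"
    using assms by (auto simp: fun_eq_iff transpose_def)
  then have "\<mu> \<circ> transpose a b \<circ> transpose c d = \<mu> \<circ> transpose c d \<circ> transpose a b"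
    by (simp only: comp_assoc)
  then show "dot_transp n (c, d) (dot_transp n (a, b) (K \<mu>)) = dot_transp n (a, b) (dot_transp n (c, d) (K \<mu>))"
    using bruhat_transp_disjoint[OF assms, of n \<mu>] by (auto simp: dot_transp_K simp del: o_apply)
qed (simp_all add: dot_transp_diff)

section \<open>Folding over one set in two different orders\<close>

lemma foldl_move_front:
  assumes "\<And>y z. y \<in> set u \<Longrightarrow> f (f z y) x = f (f z x) y"
  shows "f (foldl f z u) x = foldl f (f z x) u"
  using assms
proof (induction u arbitrary: z)
  case (Cons y u)
  then show ?case by simp
qed simp

text \<open>The elements that precede the head \<open>x\<close> in \<open>ys\<close> come after it
  in \<open>xs\<close>. They form inverted pairs with \<open>x\<close>, so \<open>x\<close> may be
  moved past them to the front.\<close>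

lemma foldl_reorder:
  assumes "sorted_wrt P xs" "sorted_wrt Q ys" "set xs = set ys"
    and "\<And>x. \<not> P x x" "\<And>x. \<not> Q x x"
    and "\<And>x y z. x \<in> set xs \<Longrightarrow> y \<in> set xs \<Longrightarrow> P x y \<Longrightarrow> Q y x \<Longrightarrow> f (f z y) x = f (f z x) y"
  shows "foldl f z xs = foldl f z ys"
  using assms(1-3,6)
proof (induction xs arbitrary: ys z)
  case (Cons x xs)
  have "x \<in> set ys" using Cons.prems(3) by auto
  then obtain u v where ys: "ys = u @ x # v" by (meson split_list)
  have Q: "sorted_wrt Q (u @ v)" "\<And>y. y \<in> set u \<Longrightarrow> Q y x" "\<And>y. y \<in> set v \<Longrightarrow> Q x y"
    using Cons.prems(2) by (auto simp: ys sorted_wrt_append)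
  have P: "sorted_wrt P xs" "\<And>y. y \<in> set xs \<Longrightarrow> P x y" using Cons.prems(1) by auto
  have notin: "x \<notin> set xs" "x \<notin> set u" "x \<notin> set v" using P(2) Q(2,3) assms(4,5) by metis+
  have set: "set xs = set (u @ v)" using Cons.prems(3) notin unfolding ys by auto
  have "foldl f z ys = foldl f (f (foldl f z u) x) v" by (simp add: ys)
  also have "f (foldl f z u) x = foldl f (f z x) u"
  proof (rule foldl_move_front)
    fix y z assume y: "y \<in> set u"
    then have "y \<in> set xs" using set by simp
    then show "f (f z y) x = f (f z x) y"
      using Cons.prems(4)[of x y z] P(2) Q(2)[OF y] by simp
  qed
  also have "foldl f (foldl f (f z x) u) v = foldl f (f z x) (u @ v)" by simp
  also have "\<dots> = foldl f (f z x) xs"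
    by (rule Cons.IH[symmetric, OF P(1) Q(1) set]) (use Cons.prems(4) in simp)
  finally show ?case by simp
qed simp

lemma sorted_wrt_set_unique:
  assumes "\<And>x y. P x y \<Longrightarrow> \<not> P y x" "sorted_wrt P xs" "sorted_wrt P ys" "set xs = set ys"
  shows "xs = ys"
  using assms(2-4)
proof (induction xs arbitrary: ys)
  case (Cons x xs)
  then obtain y ys' where ys: "ys = y # ys'" by (cases ys) auto
  have 1: "\<And>z. z \<in> set xs \<Longrightarrow> P x z" "\<And>z. z \<in> set ys' \<Longrightarrow> P y z"
    using Cons.prems by (auto simp: ys)
  have set: "insert x (set xs) = insert y (set ys')" using Cons.prems(3) ys by simp
  have "x = y"
  proof (rule ccontr)
    assume "x \<noteq> y"
    then have "y \<in> set xs" "x \<in> set ys'" using set by (metis insert_iff)+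
    then show False using 1 assms(1) by metis
  qed
  moreover have "x \<notin> set xs" "y \<notin> set ys'" using 1 assms(1) by metis+
  ultimately have "set xs = set ys'" using set by (metis insert_ident)
  then show ?case using Cons.IH[of ys'] Cons.prems \<open>x = y\<close> by (simp add: ys)
qed simp

lemma ex_sorted_wrt_of_key:
  fixes f :: "'a \<Rightarrow> nat"
  assumes "finite S" "inj_on f S" "\<And>x y. x \<in> S \<Longrightarrow> y \<in> S \<Longrightarrow> f x < f y \<Longrightarrow> P x y"
  shows "\<exists>xs. sorted_wrt P xs \<and> set xs = S"
proof (intro exI conjI)
  let ?xs = "map (inv_into S f) (sorted_list_of_set (f ` S))"
  show "set ?xs = S" using assms(1,2) by (simp add: image_inv_into_cancel image_image)
  show "sorted_wrt P ?xs"
    unfolding sorted_wrt_map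
  proof (rule sorted_wrt_mono_rel[OF _ strict_sorted_list_of_set])
    fix x y assume "x \<in> set (sorted_list_of_set (f ` S))" "y \<in> set (sorted_list_of_set (f ` S))" "x < y"
    then show "P (inv_into S f x) (inv_into S f y)"
      using assms(1) by (intro assms(3)) (simp_all add: inv_into_into f_inv_into_f)
  qed
qed

lemma radix_less_iff:
  fixes x y :: nat
  assumes "y \<le> n" "y' \<le> n"
  shows "x * Suc n + y < x' * Suc n + y' \<longleftrightarrow> x < x' \<or> x = x' \<and> y < y'"
proof -
  have "u * Suc n + v < u' * Suc n + v'" if "u < u'" "v \<le> n" for u v u' v' :: nat
  proof -
    have "u * Suc n + v < Suc u * Suc n" using that by simp
    also have "\<dots> \<le> u' * Suc n" using that by (intro mult_le_mono1) simp
    finally show ?thesis by simp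
  qed
  from this[of x x' y y'] this[of x' x y' y] show ?thesis
    using assms by (cases x x' rule: linorder_cases) simp_all
qed

text \<open>The definite description is justified: sorting by a numerical key gives existence,
  asymmetry of the order gives uniqueness.\<close>

lemma W_list_correct:
  assumes "\<sigma> permutes {1..n}"
  shows "sorted_wrt (transp_prec \<sigma>) (W_list n k \<sigma>)" "set (W_list n k \<sigma>) = k_bruhat_transps n k \<sigma>"
proof -
  let ?S = "k_bruhat_transps n k \<sigma>"
  \<comment> \<open>A two-digit number in base \<open>Suc n\<close>: the complement in the leading
    digit lets larger values at first entries come first, and values at second entries break
    ties.\<close>
  define key where "key \<tau> = (n - \<sigma> (fst \<tau>)) * Suc n + \<sigma> (snd \<tau>)" for \<tau>
  have range: "fst \<tau> \<in> {1..n} \<and> snd \<tau> \<in> {1..n} \<and> \<sigma> (fst \<tau>) \<le> n \<and> \<sigma> (snd \<tau>) \<le> n" if "\<tau> \<in> ?S" for \<tau>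
  proof -
    have "fst \<tau> \<in> {1..n}" "snd \<tau> \<in> {1..n}"
      using that by (auto simp: k_bruhat_transps_def bruhat_transp_iff)
    then show ?thesis
      using permutes_in_image[OF assms, of "fst \<tau>"] permutes_in_image[OF assms, of "snd \<tau>"] by simp
  qed
  have less: "key \<tau> < key \<tau>' \<longleftrightarrow> transp_prec \<sigma> \<tau> \<tau>'" if "\<tau> \<in> ?S" "\<tau>' \<in> ?S" for \<tau> \<tau>'
  proof -
    \<comment> \<open>Injectivity turns the tie condition on first entries into equality of leading
      digits.\<close>
    have "n - \<sigma> (fst \<tau>) = n - \<sigma> (fst \<tau>') \<longleftrightarrow> fst \<tau> = fst \<tau>'"
      using range[OF that(1)] range[OF that(2)] inj_eq[OF permutes_inj[OF assms], of "fst \<tau>" "fst \<tau>'"]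
      by arith
    moreover have "n - \<sigma> (fst \<tau>) < n - \<sigma> (fst \<tau>') \<longleftrightarrow> \<sigma> (fst \<tau>') < \<sigma> (fst \<tau>)"
      using range[OF that(1)] range[OF that(2)] by arith
    moreover have "key \<tau> < key \<tau>' \<longleftrightarrow> n - \<sigma> (fst \<tau>) < n - \<sigma> (fst \<tau>') \<or>
        n - \<sigma> (fst \<tau>) = n - \<sigma> (fst \<tau>') \<and> \<sigma> (snd \<tau>) < \<sigma> (snd \<tau>')"
      unfolding key_def using range[OF that(1)] range[OF that(2)] by (intro radix_less_iff) simp_all
    ultimately show ?thesis
      unfolding transp_prec_def split_def by (simp only:)
  qed
  have "finite ?S"
    by (rule finite_subset[of _ "{1..n} \<times> {1..n}"]) (use range in \<open>auto simp: mem_Times_iff\<close>)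
  moreover have "inj_on key ?S"
  proof (rule inj_onI)
    fix \<tau> \<tau>' assume \<tau>: "\<tau> \<in> ?S" "\<tau>' \<in> ?S" "key \<tau> = key \<tau>'"
    then have "\<not> transp_prec \<sigma> \<tau> \<tau>'" "\<not> transp_prec \<sigma> \<tau>' \<tau>"
      using less[of \<tau> \<tau>'] less[of \<tau>' \<tau>] by simp_all
    then have "\<sigma> (fst \<tau>) = \<sigma> (fst \<tau>')" "fst \<tau> = fst \<tau>' \<longrightarrow> \<sigma> (snd \<tau>) = \<sigma> (snd \<tau>')"
      by (auto simp: transp_prec_def split_def)
    then show "\<tau> = \<tau>'"
      by (simp add: inj_eq[OF permutes_inj[OF assms]] prod_eq_iff)
  qed
  ultimately obtain ts where ts: "sorted_wrt (transp_prec \<sigma>) ts" "set ts = ?S"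
    using ex_sorted_wrt_of_key[of ?S key "transp_prec \<sigma>"] less by metis
  have asym: "transp_prec \<sigma> x y \<Longrightarrow> \<not> transp_prec \<sigma> y x" for x y
    by (auto simp: transp_prec_def split_def)
  have "W_list n k \<sigma> = ts"
    unfolding W_list_def
  proof (rule the_equality)
    fix ts' assume "sorted_wrt (transp_prec \<sigma>) ts' \<and> set ts' = ?S"
    then show "ts' = ts"
      by (intro sorted_wrt_set_unique[where P = "transp_prec \<sigma>"]) (use asym ts in simp_all)
  qed (use ts in simp)
  with ts show "sorted_wrt (transp_prec \<sigma>) (W_list n k \<sigma>)" "set (W_list n k \<sigma>) = ?S" by simp_all
qed

lemma ex_lex_list: "\<exists>L. sorted_wrt lex_prec L \<and> set L = {1..k} \<times> {k<..n}"
proof (rule ex_sorted_wrt_of_key)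
  define key where "key \<tau> = fst \<tau> * Suc n + (n - snd \<tau>)" for \<tau> :: "nat \<times> nat"
  have less: "key x < key y \<longleftrightarrow> fst x < fst y \<or> fst x = fst y \<and> n - snd x < n - snd y" for x y
    unfolding key_def by (rule radix_less_iff) simp_all
  show "inj_on key ({1..k} \<times> {k<..n})"
  proof (rule inj_onI)
    fix x y assume "x \<in> {1..k} \<times> {k<..n}" "y \<in> {1..k} \<times> {k<..n}" "key x = key y"
    then show "x = y" using less[of x y] less[of y x] by (auto simp: prod_eq_iff)
  qed
  show "lex_prec x y" if "key x < key y" for x y
    using that less[of x y] by (auto simp: lex_prec_def split_def)
qed simp

lemma lex_tail_full:
  assumes "sorted_wrt lex_prec L" "set L = {1..k} \<times> {k<..n}"
  shows "lex_tail n k L"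
  using assms by (simp add: lex_tail_def)

lemma frak_E_eq_dot_prod:
  assumes \<sigma>: "\<sigma> permutes {1..n}" and L: "sorted_wrt lex_prec L" "set L = {1..k} \<times> {k<..n}"
  shows "frak_E n k \<sigma> = dot_prod n L (K \<sigma>)"
proof -
  let ?S = "k_bruhat_transps n k \<sigma>"
  let ?L = "filter (\<lambda>\<tau>. \<tau> \<in> ?S) L"
  have S: "(a, b) \<in> ?S \<longleftrightarrow> bruhat_transp n \<sigma> (a, b) \<and> a \<le> k \<and> k < b" for a b
    by (simp add: k_bruhat_transps_def)
  have "?S \<subseteq> set L" by (auto simp: L(2) k_bruhat_transps_def bruhat_transp_iff)
  then have set: "set ?L = ?S" by auto
  have "dot_prod n L (K \<sigma>) = dot_prod n ?L (K \<sigma>)"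
  proof (rule dot_prod_filter[OF L(1)])
    show "set L \<subseteq> {1..k} \<times> {k<..n}" using L(2) by simp
    fix \<tau> assume *: "\<tau> \<in> set L" "\<tau> \<notin> ?S"
    obtain a b where \<tau>: "\<tau> = (a, b)" by (cases \<tau>)
    show "\<not> bruhat_transp n \<sigma> \<tau>" using * unfolding \<tau> L(2) S by simp
  qed
  also have "\<dots> = dot_prod n (W_list n k \<sigma>) (K \<sigma>)"
    unfolding dot_prod_def
  proof (rule foldl_reorder)
    show "sorted_wrt lex_prec ?L" using L(1) by (rule sorted_wrt_filter)
    show "sorted_wrt (transp_prec \<sigma>) (W_list n k \<sigma>)" by (rule W_list_correct[OF \<sigma>])
    show "set ?L = set (W_list n k \<sigma>)" by (simp only: set W_list_correct[OF \<sigma>])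
    show "\<not> lex_prec x x" "\<not> transp_prec \<sigma> x x" for x
      by (auto simp: lex_prec_def transp_prec_def split_def)
    fix x y z assume xy: "x \<in> set ?L" "y \<in> set ?L" "lex_prec x y" "transp_prec \<sigma> y x"
    obtain a b c d where x: "x = (a, b)" and y: "y = (c, d)" by (cases x, cases y)
    have "(a, b) \<in> ?S" "(c, d) \<in> ?S" using xy(1,2) unfolding set x y by simp_all
    then have cov: "bruhat_cover \<sigma> a b" "bruhat_cover \<sigma> c d" and k: "a \<le> k" "k < b" "c \<le> k" "k < d"
      unfolding S bruhat_transp_iff by simp_all
    have lt: "\<sigma> a < \<sigma> b" "\<sigma> c < \<sigma> d" using cov by (simp_all add: bruhat_cover_def)
    \<comment> \<open>With a common first entry the two orders would give \<open>d < b\<close> and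
      \<sigma> d < \<sigma> b, so \<open>d\<close> would obstruct the cover
      \<open>(a, b)\<close>.\<close>
    have "a \<noteq> c"
    proof
      assume "a = c"
      then have "d < b" "\<sigma> d < \<sigma> b" using xy(3,4) by (auto simp: x y lex_prec_def transp_prec_def)
      then show False using cov(1) k lt \<open>a = c\<close> unfolding bruhat_cover_def by (metis le_less_trans)
    qed
    then have "a < c" "\<sigma> a < \<sigma> c" using xy(3,4) by (auto simp: x y lex_prec_def transp_prec_def)
    \<comment> \<open>With a common second entry, \<open>c\<close> would obstruct the cover
      \<open>(a, b)\<close>.\<close>
    then have "b \<noteq> d" using cov(1) k lt unfolding bruhat_cover_def by (metis le_less_trans)
    then have "dot_transp n x (dot_transp n y z) = dot_transp n y (dot_transp n x z)"
      using dot_transp_commute[of c a b d n z] \<open>a \<noteq> c\<close> k unfolding x y by simp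
    then show "z - dot_transp n y z - dot_transp n x (z - dot_transp n y z) =
        z - dot_transp n x z - dot_transp n y (z - dot_transp n x z)"
      by (simp add: dot_transp_diff)
  qed
  finally show ?thesis by (simp add: frak_E_def dot_prod_def)
qed

section \<open>The left-hand side\<close>

lemma longest_perm_permutes: "longest_perm n permutes {1..n}"
proof (rule bij_imp_permutes)
  show "bij_betw (longest_perm n) {1..n} {1..n}"
    by (rule bij_betw_byWitness[where f' = "longest_perm n"]) (auto simp: longest_perm_def)
qed (simp only: longest_perm_def if_False)

lemma longest_perm_comp_self: "longest_perm n \<circ> longest_perm n = id"
  by (auto simp: longest_perm_def fun_eq_iff)

lemma longest_perm_less:
  "x \<in> {1..n} \<Longrightarrow> y \<in> {1..n} \<Longrightarrow> x < y \<Longrightarrow> longest_perm n y < longest_perm n x"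
  by (auto simp: longest_perm_def)

lemma longest_perm_comp_simple_transp:
  assumes "i \<in> {1..<n}"
  shows "longest_perm n \<circ> simple_transp i = simple_transp (n - i) \<circ> longest_perm n"
proof -
  have "longest_perm n (Suc i) = n - i" "longest_perm n i = Suc (n - i)"
    using assms by (auto simp: longest_perm_def)
  from simple_transp_comp_eq[OF permutes_inj[OF longest_perm_permutes] this]
  show ?thesis by (simp add: transpose_commute)
qed

text \<open>Each letter of a reduced word meets an ascent of the preceding product, which \<omega>
  turns into a descent; so no letter acts trivially.\<close>

lemma foldl_pi_op_longest:
  assumes "reduced_word n v"
  shows "foldl (\<lambda>y i. pi_op i y) (K (longest_perm n)) v = K (longest_perm n \<circ> word_perm v)"
  using assms
proof (induction v rule: rev_induct)
  case (snoc i v)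
  note red = reduced_word_snocD[OF snoc.prems]
  have "word_perm v permutes {1..n}"
    using red(1) word_perm_permutes unfolding reduced_word_def by blast
  then have "word_perm v i \<in> {1..n}" "word_perm v (Suc i) \<in> {1..n}"
    using red(2) permutes_in_image[of "word_perm v" "{1..n}"] by auto
  then have "(longest_perm n \<circ> word_perm v) (Suc i) < (longest_perm n \<circ> word_perm v) i"
    unfolding o_apply using red(3) longest_perm_less by blast
  then show ?case
    unfolding foldl_append foldl.simps snoc.IH[OF red(1)] pi_op_K word_perm_snoc comp_assoc[symmetric]
    by (simp only: if_True)
qed simp

lemma foldl_left_op:
  assumes "set w \<subseteq> {1..<n}" "j \<in> {1..<n}"
  shows "foldl (\<lambda>y i. pi_op i y) (left_op n j x - x) w =
      left_op n j (foldl (\<lambda>y i. pi_op i y) x w) - foldl (\<lambda>y i. pi_op i y) x w"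
    and "foldl (\<lambda>y i. pi_hat_op i y) (left_op n j x - x) w =
      left_op n j (foldl (\<lambda>y i. pi_hat_op i y) x w) - foldl (\<lambda>y i. pi_hat_op i y) x w"
  using assms(1)
proof (induction w arbitrary: x)
  case (Cons i w)
  {
    case 1
    have "pi_op i (left_op n j x - x) = left_op n j (pi_op i x) - pi_op i x"
      using 1 assms(2) by (simp add: pi_op_diff left_op_pi_op)
    then show ?case using 1 Cons.IH(1)[of "pi_op i x"] by simp
  next
    case 2
    have "pi_hat_op i (left_op n j x - x) = left_op n j (pi_hat_op i x) - pi_hat_op i x"
      using 2 assms(2) by (simp add: pi_hat_op_diff left_op_pi_hat_op)
    then show ?case using 2 Cons.IH(2)[of "pi_hat_op i x"] by simp
  }
qed simp_all

definition block_decreasing :: "nat \<Rightarrow> nat \<Rightarrow> (nat \<Rightarrow> nat) \<Rightarrow> bool" where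
  "block_decreasing n k \<zeta> \<longleftrightarrow>
    (\<forall>a b. 1 \<le> a \<and> a < b \<and> b \<le> n \<and> (b \<le> k \<or> k < a) \<longrightarrow> \<zeta> b < \<zeta> a)"

text \<open>The induction strips letters from the front of \<open>w\<close>, where they act on
  \<open>K (longest_perm n)\<close> itself. The word \<open>v\<close> stays fixed, and its product
  preserves both blocks of positions.\<close>

lemma foldl_pi_op_pi_hat_op:
  assumes L: "sorted_wrt lex_prec L" "set L = {1..k} \<times> {k<..n}"
    and v: "reduced_word n v" and vk: "\<And>x. x \<in> {1..n} \<Longrightarrow> word_perm v x \<le> k \<longleftrightarrow> x \<le> k"
    and "reduced_word n w" "block_decreasing n k (longest_perm n \<circ> word_perm w)"
  shows "foldl (\<lambda>y i. pi_op i y) (foldl (\<lambda>y i. pi_hat_op i y) (K (longest_perm n)) w) v =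
    dot_prod n L (K (longest_perm n \<circ> word_perm w \<circ> word_perm v))"
  using assms(5,6)
proof (induction w)
  let ?\<omega> = "longest_perm n" and ?u = "word_perm v"
  have u: "?u permutes {1..n}"
    using v word_perm_permutes unfolding reduced_word_def by blast
  case Nil
  let ?\<mu> = "?\<omega> \<circ> ?u"
  \<comment> \<open>The product of \<open>v\<close> preserves the blocks and \<omega> reverses
    values, so no pair of the list is an ascent; filtering by the empty set leaves no
    factor.\<close>
  have "dot_prod n L (K ?\<mu>) = dot_prod n (filter (\<lambda>\<tau>. \<tau> \<in> {}) L) (K ?\<mu>)"
  proof (rule dot_prod_filter[OF L(1)])
    show "set L \<subseteq> {1..k} \<times> {k<..n}" using L(2) by simp
    fix \<tau> assume *: "\<tau> \<in> set L"
    obtain a b where \<tau>: "\<tau> = (a, b)" by (cases \<tau>)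
    have ab: "1 \<le> a" "a \<le> k" "k < b" "b \<le> n" using * unfolding \<tau> L(2) by auto
    have "?u a \<in> {1..n}" "?u b \<in> {1..n}"
      unfolding permutes_in_image[OF u] using ab by auto
    moreover have "?u a < ?u b" using vk[of a] vk[of b] ab by simp
    ultimately have "?\<mu> b < ?\<mu> a" using longest_perm_less by simp
    then show "\<not> bruhat_transp n ?\<mu> \<tau>" by (simp add: \<tau> bruhat_transp_iff bruhat_cover_def)
  qed
  then have "dot_prod n L (K ?\<mu>) = K ?\<mu>" by simp
  then show ?case
    unfolding foldl.simps word_perm_Nil comp_id foldl_pi_op_longest[OF v] by (rule sym)
next
  let ?\<omega> = "longest_perm n" and ?u = "word_perm v"
  have u: "?u permutes {1..n}"
    using v word_perm_permutes unfolding reduced_word_def by blast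
  case (Cons i w)
  let ?W = "word_perm w" and ?t = "simple_transp (n - i)"
  have w: "set w \<subseteq> {1..<n}" and i: "i \<in> {1..<n}"
    using Cons.prems(1) by (auto simp: reduced_word_def)
  have W: "?W permutes {1..n}" by (rule word_perm_permutes[OF w])
  have j: "n - i \<in> {1..<n}" using i by auto
  obtain p q where pq: "?W p = i" "?W q = Suc i" "p \<in> {1..n}" "q \<in> {1..n}"
    using permutes_obtain_positions[OF W i] by metis
  note red = reduced_word_ConsD[OF Cons.prems(1) pq(1,2)]
  let ?\<zeta>' = "?\<omega> \<circ> ?W"
  have \<omega>t: "?\<omega> \<circ> simple_transp i = ?t \<circ> ?\<omega>" by (rule longest_perm_comp_simple_transp[OF i])
  have \<zeta>: "?\<omega> \<circ> word_perm (i # w) = ?t \<circ> ?\<zeta>'"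
    unfolding word_perm_Cons comp_assoc[symmetric] \<omega>t ..
  have \<omega>i: "?\<omega> i = Suc (n - i)" "?\<omega> (Suc i) = n - i"
    using i by (auto simp: longest_perm_def)
  have \<zeta>': "?\<zeta>' permutes {1..n}" using permutes_compose[OF W longest_perm_permutes] .
  have \<zeta>'pq: "?\<zeta>' p = Suc (n - i)" "?\<zeta>' q = n - i" using \<omega>i pq by simp_all
  \<comment> \<open>Within one block the values \<open>n - i\<close> at \<open>p\<close> and
    \<open>Suc (n - i)\<close> at \<open>q\<close> would be an ascent of the block-decreasing
    permutation.\<close>
  have "p \<le> k \<and> k < q"
  proof (rule ccontr)
    assume "\<not> (p \<le> k \<and> k < q)"
    then have "q \<le> k \<or> k < p" using red(3) by auto
    then have "(?t \<circ> ?\<zeta>') q < (?t \<circ> ?\<zeta>') p"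
      using Cons.prems(2) red(3) pq(3,4) unfolding \<zeta> block_decreasing_def by simp
    then show False using \<zeta>'pq by simp
  qed
  then have k: "p \<le> k" "k < q" by simp_all
  \<comment> \<open>Only the comparison of \<open>p\<close> with \<open>q\<close> has changed, and
    these lie in different blocks.\<close>
  have "block_decreasing n k ?\<zeta>'"
    unfolding block_decreasing_def
  proof (intro allI impI)
    fix a b assume ab: "1 \<le> a \<and> a < b \<and> b \<le> n \<and> (b \<le> k \<or> k < a)"
    have eq: "?\<zeta>' x = n - i \<longleftrightarrow> x = q" "?\<zeta>' x = Suc (n - i) \<longleftrightarrow> x = p" for x
      using inj_eq[OF permutes_inj[OF \<zeta>'], of x q] inj_eq[OF permutes_inj[OF \<zeta>'], of x p]
      by (simp_all only: \<zeta>'pq)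
    have "{?\<zeta>' b, ?\<zeta>' a} \<noteq> {n - i, Suc (n - i)}"
      unfolding doubleton_eq_iff eq using ab k by linarith
    moreover have "?\<zeta>' b \<noteq> ?\<zeta>' a"
      using ab inj_eq[OF permutes_inj[OF \<zeta>'], of b a] by simp
    moreover have "?t (?\<zeta>' b) < ?t (?\<zeta>' a)"
      using Cons.prems(2) ab unfolding \<zeta> block_decreasing_def by simp
    ultimately show "?\<zeta>' b < ?\<zeta>' a" using simple_transp_less_iff by metis
  qed
  note IH = Cons.IH[OF red(1) this]
  let ?\<sigma>' = "?\<zeta>' \<circ> ?u"
  have \<sigma>': "?\<sigma>' permutes {1..n}" using permutes_compose[OF u \<zeta>'] .
  have \<sigma>: "?t \<circ> ?\<sigma>' permutes {1..n}" by (rule simple_transp_comp_permutes[OF \<sigma>' j])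
  \<comment> \<open>The positions of the two values after multiplication by
    \<open>word_perm v\<close>. No position crosses \<open>k\<close>, so \<open>(p', q')\<close>
    occurs in the list and the correction term is present.\<close>
  define p' q' where "p' = inv ?u p" and "q' = inv ?u q"
  have u': "?u p' = p" "?u q' = q"
    unfolding p'_def q'_def using permutes_inverses(1)[OF u] by simp_all
  have n': "p' \<in> {1..n}" "q' \<in> {1..n}"
    unfolding p'_def q'_def permutes_in_image[OF permutes_inv[OF u]] by (rule pq(3), rule pq(4))
  then have k': "p' \<le> k" "k < q'" using vk[of p'] vk[of q'] k u' by simp_all
  then have mem: "(p', q') \<in> set L" using n' L(2) by simp
  have "(?t \<circ> ?\<sigma>') p' = n - i" "(?t \<circ> ?\<sigma>') q' = Suc (n - i)" using u' \<zeta>'pq by simp_all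
  note left = dot_prod_left_op[OF lex_tail_full[OF L] \<sigma> j this]
  have tt: "?t \<circ> (?t \<circ> ?\<sigma>') = ?\<sigma>'"
    unfolding comp_assoc[symmetric] transpose_comp_involutory id_comp ..
  have "p' < q'" using k' by simp
  from left[OF this]
  have G: "dot_prod n L (K (?t \<circ> ?\<sigma>')) = left_op n (n - i) (dot_prod n L (K ?\<sigma>')) - dot_prod n L (K ?\<sigma>')"
    unfolding tt if_P[OF mem] .
  \<comment> \<open>In \<omega> the positions \<open>i\<close> and \<open>Suc i\<close> hold
    neighbouring values in descending order, so the right operator acts here as the left one with
    index \<open>n - i\<close>.\<close>
  have "pi_op i (K ?\<omega>) = K (?t \<circ> ?\<omega>)"
    using \<omega>i \<omega>t by (simp add: pi_op_K)
  also have "\<dots> = left_op n (n - i) (K ?\<omega>)"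
    using left_op_K[OF longest_perm_permutes \<omega>i(2,1)] by simp
  finally have "pi_hat_op i (K ?\<omega>) = left_op n (n - i) (K ?\<omega>) - K ?\<omega>"
    by (simp add: pi_hat_op_def)
  then have "foldl (\<lambda>y i. pi_op i y) (foldl (\<lambda>y i. pi_hat_op i y) (K ?\<omega>) (i # w)) v =
      left_op n (n - i) (dot_prod n L (K ?\<sigma>')) - dot_prod n L (K ?\<sigma>')"
    using v IH unfolding reduced_word_def
    by (simp add: foldl_left_op(2)[OF w j] foldl_left_op(1)[OF _ j] del: o_apply)
  also have "\<dots> = dot_prod n L (K (?\<omega> \<circ> word_perm (i # w) \<circ> ?u))"
    unfolding \<zeta> comp_assoc G[unfolded comp_assoc] ..
  finally show ?case .
qed

section \<open>The maximal coset representative\<close>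

text \<open>A crude bound; it ensures that the maximum defining \<open>zeta\<close> is
  attained.\<close>

lemma inv_num_le_square: "inv_num n \<mu> \<le> n * n"
proof -
  have "inv_num n \<mu> \<le> card ({1..n} \<times> {1..n})"
    unfolding inv_num_def by (rule card_mono) auto
  then show ?thesis by (simp add: card_cartesian_product)
qed

lemma zeta_maximal:
  assumes "\<sigma> permutes {1..n}"
  shows "\<exists>\<rho>\<in>young_subgroup n k. zeta n k \<sigma> = \<sigma> \<circ> \<rho> \<and>
    (\<forall>\<rho>'\<in>young_subgroup n k. inv_num n (\<sigma> \<circ> \<rho>') \<le> inv_num n (\<sigma> \<circ> \<rho>))"
proof -
  let ?C = "(\<lambda>\<rho>. \<sigma> \<circ> \<rho>) ` young_subgroup n k"
  have C: "cox_length n \<xi> = inv_num n \<xi>" if "\<xi> \<in> ?C" for \<xi>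
  proof (rule cox_length_eq_inv_num)
    show "\<xi> permutes {1..n}"
      using that permutes_compose[OF _ assms] by (auto simp: young_subgroup_def)
  qed
  have "id \<in> young_subgroup n k" using permutes_id[of "{1..n}"] by (simp add: young_subgroup_def)
  then have "\<sigma> \<circ> id \<in> ?C" by (rule imageI)
  moreover have "\<forall>\<xi>. \<xi> \<in> ?C \<longrightarrow> cox_length n \<xi> < Suc (n * n)"
    using C inv_num_le_square by (simp add: less_Suc_eq_le)
  ultimately have "zeta n k \<sigma> \<in> ?C \<and> (\<forall>\<xi>. \<xi> \<in> ?C \<longrightarrow> cox_length n \<xi> \<le> cox_length n (zeta n k \<sigma>))"
    unfolding zeta_def by (rule arg_max_nat_lemma)
  then have z: "zeta n k \<sigma> \<in> ?C" "\<And>\<xi>. \<xi> \<in> ?C \<Longrightarrow> inv_num n \<xi> \<le> inv_num n (zeta n k \<sigma>)"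
    using C by metis+
  then obtain \<rho> where \<rho>: "\<rho> \<in> young_subgroup n k" "zeta n k \<sigma> = \<sigma> \<circ> \<rho>" by (elim imageE)
  show ?thesis
    by (rule bexI[OF _ \<rho>(1)]) (use z(2) in \<open>simp add: \<rho>(2)\<close>)
qed

text \<open>An ascent inside a block could be exchanged within the coset, raising the length against
  maximality. The last two claims hold because
  \<open>inv (zeta n k \<sigma>) \<circ> \<sigma>\<close> is the inverse of an element of the Young
  subgroup.\<close>

lemma zeta_properties:
  assumes "\<sigma> permutes {1..n}"
  shows "zeta n k \<sigma> permutes {1..n}" "block_decreasing n k (zeta n k \<sigma>)"
    "inv (zeta n k \<sigma>) \<circ> \<sigma> permutes {1..n}"
    "x \<in> {1..n} \<Longrightarrow> (inv (zeta n k \<sigma>) \<circ> \<sigma>) x \<le> k \<longleftrightarrow> x \<le> k"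
proof -
  obtain \<rho> where \<rho>: "\<rho> \<in> young_subgroup n k" and \<zeta>: "zeta n k \<sigma> = \<sigma> \<circ> \<rho>"
    and max: "\<And>\<rho>'. \<rho>' \<in> young_subgroup n k \<Longrightarrow> inv_num n (\<sigma> \<circ> \<rho>') \<le> inv_num n (\<sigma> \<circ> \<rho>)"
    using zeta_maximal[OF assms, of k] by metis
  have \<rho>p: "\<rho> permutes {1..n}" and im: "\<rho> ` {1..k} = {1..k}"
    using \<rho> by (simp_all add: young_subgroup_def)
  show \<zeta>p: "zeta n k \<sigma> permutes {1..n}"
    unfolding \<zeta> by (rule permutes_compose[OF \<rho>p assms])
  have eq: "inv (zeta n k \<sigma>) \<circ> \<sigma> = inv \<rho>"
    unfolding \<zeta> o_inv_distrib[OF permutes_bij[OF assms] permutes_bij[OF \<rho>p]] comp_assoc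
      permutes_inv_o(2)[OF assms] by simp
  show "inv (zeta n k \<sigma>) \<circ> \<sigma> permutes {1..n}"
    unfolding eq by (rule permutes_inv[OF \<rho>p])
  show "(inv (zeta n k \<sigma>) \<circ> \<sigma>) x \<le> k \<longleftrightarrow> x \<le> k" if "x \<in> {1..n}"
  proof -
    have "inv \<rho> x \<in> {1..n}" using that permutes_in_image[OF permutes_inv[OF \<rho>p]] by simp
    moreover have "\<rho> (inv \<rho> x) = x" by (rule permutes_inverses(1)[OF \<rho>p])
    moreover have "\<rho> (inv \<rho> x) \<in> {1..k} \<longleftrightarrow> inv \<rho> x \<in> {1..k}"
      using inj_image_mem_iff[OF permutes_inj[OF \<rho>p], of "inv \<rho> x" "{1..k}"] im by simp
    ultimately show ?thesis unfolding eq using that by simp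
  qed
  show "block_decreasing n k (zeta n k \<sigma>)"
    unfolding block_decreasing_def
  proof (intro allI impI)
    fix a b assume ab: "1 \<le> a \<and> a < b \<and> b \<le> n \<and> (b \<le> k \<or> k < a)"
    have "(\<rho> \<circ> transpose a b) ` {1..k} = \<rho> ` transpose a b ` {1..k}" by (simp only: image_comp)
    also have "transpose a b ` {1..k} = {1..k}" by (rule transpose_image_eq) (use ab in auto)
    finally have "\<rho> \<circ> transpose a b \<in> young_subgroup n k"
      using permutes_transpose_comp[OF \<rho>p, of a b] ab im unfolding young_subgroup_def by simp
    from max[OF this] have "inv_num n (zeta n k \<sigma> \<circ> transpose a b) \<le> inv_num n (zeta n k \<sigma>)"
      unfolding \<zeta> comp_assoc .
    then have "\<not> zeta n k \<sigma> a < zeta n k \<sigma> b"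
      using inv_num_less_comp_transpose[OF \<zeta>p, of a b] ab by linarith
    moreover have "zeta n k \<sigma> a \<noteq> zeta n k \<sigma> b"
      using ab inj_eq[OF permutes_inj[OF \<zeta>p], of a b] by simp
    ultimately show "zeta n k \<sigma> b < zeta n k \<sigma> a" by simp
  qed
qed

theorem proposition4p2:
  fixes n k :: nat and \<sigma> :: "nat \<Rightarrow> nat"
  assumes "\<sigma> permutes {1..n}" and "1 \<le> k" and "k < n"
  shows "pi_perm n (inv (zeta n k \<sigma>) \<circ> \<sigma>)
           (pi_hat_perm n (longest_perm n \<circ> zeta n k \<sigma>) (K (longest_perm n)))
         = frak_E n k \<sigma>"
proof -
  let ?\<omega> = "longest_perm n" and ?\<zeta> = "zeta n k \<sigma>"
  note z = zeta_properties[OF assms(1)]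
  obtain L where L: "sorted_wrt lex_prec L" "set L = {1..k} \<times> {k<..n}"
    using ex_lex_list by metis
  \<comment> \<open>Of the chosen words only their reducedness and their products enter
    below.\<close>
  define w where "w = (SOME w. reduced_word_for n (?\<omega> \<circ> ?\<zeta>) w)"
  define v where "v = (SOME w. reduced_word_for n (inv ?\<zeta> \<circ> \<sigma>) w)"
  have w: "reduced_word n w" "word_perm w = ?\<omega> \<circ> ?\<zeta>"
    unfolding w_def using some_reduced_word[OF permutes_compose[OF z(1) longest_perm_permutes]] .
  have v: "reduced_word n v" "word_perm v = inv ?\<zeta> \<circ> \<sigma>"
    unfolding v_def using some_reduced_word[OF z(3)] .
  have \<omega>w: "?\<omega> \<circ> word_perm w = ?\<zeta>"
    unfolding w(2) comp_assoc[symmetric] longest_perm_comp_self by simp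
  have "pi_perm n (inv ?\<zeta> \<circ> \<sigma>) (pi_hat_perm n (?\<omega> \<circ> ?\<zeta>) (K ?\<omega>)) =
      dot_prod n L (K (?\<omega> \<circ> word_perm w \<circ> word_perm v))"
    unfolding pi_perm_def pi_hat_perm_def w_def[symmetric] v_def[symmetric]
  proof (rule foldl_pi_op_pi_hat_op[OF L v(1) _ w(1)])
    show "word_perm v x \<le> k \<longleftrightarrow> x \<le> k" if "x \<in> {1..n}" for x
      unfolding v(2) by (rule z(4)[OF that])
    show "block_decreasing n k (?\<omega> \<circ> word_perm w)" unfolding \<omega>w by (rule z(2))
  qed
  also have "?\<omega> \<circ> word_perm w \<circ> word_perm v = \<sigma>"
    unfolding \<omega>w v(2) comp_assoc[symmetric] permutes_inv_o(1)[OF z(1)] by simp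
  also have "dot_prod n L (K \<sigma>) = frak_E n k \<sigma>"
    by (rule frak_E_eq_dot_prod[OF assms(1) L, symmetric])
  finally show ?thesis .
qed

end
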